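(* Let $f,g\in\mathcal{O}_2=\mathbb{C}\{x,y\}$ be relatively prime, such that the $1$-form $\omega_{f/g}=g\,df-f\,dg$ has an isolated singularity at $0\in\mathbb{C}^2$. Let $[\alpha:\beta]\in\mathbb{P}^1$ and let $C_{[\alpha:\beta]}:\alpha f+\beta g=0$ be a reduced curve. Then $$\tau_{[\alpha:\beta]}(f,g)=\tau(C_{[\alpha:\beta]})+\mu(f,g)-\nu(f,g).$$
   Context: $\mathcal{O}_2=\mathbb{C}\{x,y\}$ is the ring of convergent power series. For a reduced plane curve germ $C:h=0$ the Tjurina number is $\tau(C)=\dim_{\mathbb{C}}\mathcal{O}_2/(h,h_x,h_y)$. The Tjurina number of the pair $(f,g)$ with respect to the fiber $C_{[\alpha:\beta]}$ is $$\tau_{[\alpha:\beta]}(f,g):=\dim_{\mathbb{C}}\frac{\mathcal{O}_2}{(gf_x-fg_x,\ gf_y-fg_y,\ \alpha f+\beta g)}.$$ The Milnor number of the pair is $\mu(f,g):=\dim_{\mathbb{C}}\mathcal{O}_2/(gf_x-fg_x,\ gf_y-fg_y)$, and Suwa's invariant is $$\nu(f,g):=\dim_{\mathbb{C}}\frac{(f,g)}{(gf_x-fg_x,\ gf_y-fg_y)},$$ where $(f,g)$ is the ideal generated by $f$ and $g$. The form $\omega_{f/g}=(gf_x-fg_x)\,dx+(gf_y-fg_y)\,dy$ has an isolated singularity at $0$ when its two coefficients have no common zero in a punctured neighbourhood of $0$. *)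

theory Defs
  imports
    "HOL-Analysis.Analysis"
    "HOL-Computational_Algebra.Formal_Power_Series"
    "HOL-Computational_Algebra.Squarefree"
    "HOL-Library.Extended_Nat"
begin

unbundle no vec_syntax
unbundle fps_syntax

section \<open>Dimension of a quotient of vector spaces\<close>

locale vector_space_quotient = vector_space
begin

text \<open>\<open>B\<close> is a finite set of representatives, pairwise distinct modulo \<open>W\<close>, of a basis of the
  quotient space \<open>V / W\<close> (for subspaces \<open>W \<subseteq> V\<close>): its classes are linearly independent
  and they span.\<close>

definition quot_basis :: "'b set \<Rightarrow> 'b set \<Rightarrow> 'b set \<Rightarrow> bool" where
  "quot_basis V W B \<longleftrightarrow> finite B \<and> B \<subseteq> V \<and>
     (\<forall>u. (\<Sum>b\<in>B. u b *s b) \<in> W \<longrightarrow> (\<forall>b\<in>B. u b = 0)) \<and>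
     (\<forall>v\<in>V. \<exists>u. v - (\<Sum>b\<in>B. u b *s b) \<in> W)"

definition quot_dim :: "'b set \<Rightarrow> 'b set \<Rightarrow> enat" where
  "quot_dim V W = (if \<exists>B. quot_basis V W B then enat (card (SOME B. quot_basis V W B)) else \<infinity>)"

lemma quot_basis_card_le:
  assumes W: "subspace W" and B: "quot_basis V W B" and C: "quot_basis V W C"
  shows "card C \<le> card B"
proof -
  have CV: "C \<subseteq> V"
    and indC: "\<And>u. (\<Sum>c\<in>C. u c *s c) \<in> W \<Longrightarrow> \<forall>c\<in>C. u c = 0"
    using C by (simp_all add: quot_basis_def)
  have "\<forall>v\<in>V. \<exists>u. v - (\<Sum>b\<in>B. u b *s b) \<in> W"
    using B by (simp add: quot_basis_def)
  with CV have "\<forall>c\<in>C. \<exists>u. c - (\<Sum>b\<in>B. u b *s b) \<in> W"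
    by (meson subsetD)
  then obtain a where a: "\<And>c. c \<in> C \<Longrightarrow> c - (\<Sum>b\<in>B. a c b *s b) \<in> W"
    by metis
  define p where "p c = (\<Sum>b\<in>B. a c b *s b)" for c
  have fin: "finite C" "finite B"
    using B C by (auto simp: quot_basis_def)
  have key: "\<forall>c\<in>C. u c = 0" if "(\<Sum>c\<in>C. u c *s p c) = 0" for u
  proof -
    have "(\<Sum>c\<in>C. u c *s (c - p c)) \<in> W"
      using a by (intro subspace_sum[OF W] subspace_scale[OF W]) (auto simp: p_def)
    also have "(\<Sum>c\<in>C. u c *s (c - p c)) = (\<Sum>c\<in>C. u c *s c)"
      using that by (simp add: scale_right_diff_distrib sum_subtractf)
    finally show ?thesis
      by (rule indC)
  qed
  have inj: "inj_on p C"
  proof (rule inj_onI, rule ccontr)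
    fix c d assume cd: "c \<in> C" "d \<in> C" "p c = p d" "c \<noteq> d"
    define u where "u = (\<lambda>e. if e = c then 1 else if e = d then - 1 else (0::'a))"
    have "(\<Sum>e\<in>C. u e *s p e) = (\<Sum>e\<in>{c,d}. u e *s p e)"
      using cd fin by (intro sum.mono_neutral_right) (auto simp: u_def)
    also have "\<dots> = 0"
      using cd by (simp add: u_def)
    finally have "u c = 0"
      using key cd by blast
    then show False by (simp add: u_def)
  qed
  have "independent (p ` C)"
  proof
    assume "dependent (p ` C)"
    then obtain u v where u: "v \<in> p ` C" "u v \<noteq> 0" "(\<Sum>w\<in>p ` C. u w *s w) = 0"
      using fin by (auto simp: dependent_finite)
    then have "(\<Sum>c\<in>C. u (p c) *s p c) = 0"
      by (simp add: sum.reindex[OF inj])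
    then have "\<forall>c\<in>C. u (p c) = 0"
      by (rule key)
    with u show False by auto
  qed
  moreover have "p ` C \<subseteq> span B"
    unfolding p_def by (intro image_subsetI span_sum span_scale span_base)
  ultimately have "card (p ` C) \<le> card B"
    using independent_span_bound[OF fin(2)] by blast
  then show ?thesis
    by (simp add: card_image[OF inj])
qed

lemma quot_dim_eq_card:
  assumes "subspace W" "quot_basis V W B"
  shows "quot_dim V W = enat (card B)"
  using assms quot_basis_card_le[OF assms(1)]
  unfolding quot_dim_def by (metis (mono_tags) antisym someI_ex)

end


section \<open>The ring of convergent power series in two variables\<close>

text \<open>A series \<open>\<Sum> a\<^sub>i\<^sub>j x\<^sup>i y\<^sup>j\<close> is represented by \<open>F :: complex fps fps\<close> with
  \<open>F $ i $ j = a\<^sub>i\<^sub>j\<close>: the outer variable is \<open>x\<close>, the inner one is \<open>y\<close>.\<close>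

definition convergent2 :: "complex fps fps \<Rightarrow> bool" where
  "convergent2 F \<longleftrightarrow> (\<exists>r>0. \<forall>x y. norm x < r \<and> norm y < r \<longrightarrow>
     (\<lambda>(i, j). F $ i $ j * x ^ i * y ^ j) summable_on UNIV)"

lemma convergent2_imp_bound:
  assumes "convergent2 F"
  obtains K where "K \<ge> 1" "\<And>i j. norm (F $ i $ j) \<le> K ^ (i + j + 1)"
proof -
  obtain r where r: "r > 0" and
    *: "\<And>x y. norm x < r \<Longrightarrow> norm y < r \<Longrightarrow> (\<lambda>(i, j). F $ i $ j * x ^ i * y ^ j) summable_on UNIV"
    using assms unfolding convergent2_def by blast
  define s where "s = r / 2"
  have s: "s > 0" "norm (complex_of_real s) < r"
    using r by (auto simp: s_def)
  define g where "g = (\<lambda>(i, j). F $ i $ j * complex_of_real s ^ i * complex_of_real s ^ j)"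
  have "g summable_on UNIV"
    unfolding g_def using * s by blast
  then have abs: "(\<lambda>p. norm (g p)) summable_on UNIV"
    by (simp add: summable_on_iff_abs_summable_on_complex)
  define M where "M = infsum (\<lambda>p. norm (g p)) UNIV"
  have M: "norm (g p) \<le> M" for p
    using finite_sum_le_infsum[OF abs, of "{p}"] by (simp add: M_def)
  define K where "K = max 1 (max M (1 / s))"
  have K: "K \<ge> 1" "M \<le> K" "1 / s \<le> K"
    by (auto simp: K_def)
  have "norm (F $ i $ j) \<le> K ^ (i + j + 1)" for i j
  proof -
    have "norm (F $ i $ j) * s ^ (i + j) \<le> M"
      using M[of "(i, j)"] s by (simp add: g_def norm_mult norm_power power_add mult.assoc)
    then have "norm (F $ i $ j) \<le> M * (1 / s) ^ (i + j)"
      using s by (simp add: field_simps power_one_over)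
    also have "\<dots> \<le> K * K ^ (i + j)"
      using K s by (intro mult_mono power_mono) auto
    finally show ?thesis by simp
  qed
  with K(1) that show ?thesis by blast
qed

lemma bound_imp_convergent2:
  assumes "\<And>i j. norm (F $ i $ j) \<le> K ^ (i + j + 1)" and "K \<ge> 1"
  shows "convergent2 F"
  unfolding convergent2_def
proof (intro exI[of _ "1 / (2 * K)"] conjI allI impI)
  show "1 / (2 * K) > 0" using assms by simp
  fix x y :: complex
  assume xy: "norm x < 1 / (2 * K) \<and> norm y < 1 / (2 * K)"
  have geo: "(\<lambda>n. (1 / 2 :: real) ^ n) summable_on UNIV"
    by (intro summable_nonneg_imp_summable_on summable_geometric) auto
  have "(\<lambda>(i, j). ((1 / 2 :: real) ^ i * (1 / 2) ^ j)) summable_on UNIV \<times> UNIV"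
    by (rule summable_on_SigmaI[where g = "\<lambda>i. (1 / 2) ^ i * infsum (\<lambda>j. (1 / 2) ^ j) UNIV"])
       (auto intro!: has_sum_cmult_right summable_on_cmult_left has_sum_infsum geo)
  then have "(\<lambda>(i, j). K * ((1 / 2 :: real) ^ i * (1 / 2) ^ j)) summable_on UNIV"
    using summable_on_cmult_right[of "\<lambda>(i, j). ((1 / 2 :: real) ^ i * (1 / 2) ^ j)" UNIV K]
    by (simp add: case_prod_unfold)
  then have "(\<lambda>p. norm (case p of (i, j) \<Rightarrow> F $ i $ j * x ^ i * y ^ j)) summable_on UNIV"
  proof (rule summable_on_comparison_test)
    fix p :: "nat \<times> nat"
    obtain i j where p: "p = (i, j)" by force
    have "norm (F $ i $ j * x ^ i * y ^ j) \<le> K ^ (i + j + 1) * (1 / (2 * K)) ^ i * (1 / (2 * K)) ^ j"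
      unfolding norm_mult norm_power using xy assms
      by (intro mult_mono power_mono mult_nonneg_nonneg zero_le_power) auto
    also have "\<dots> = K * ((1 / 2) ^ i * (1 / 2) ^ j)"
      using assms(2) by (simp add: power_divide power_mult_distrib power_add)
    finally show "norm (case p of (i, j) \<Rightarrow> F $ i $ j * x ^ i * y ^ j)
        \<le> (case p of (i, j) \<Rightarrow> K * ((1 / 2) ^ i * (1 / 2) ^ j))"
      by (simp add: p)
  qed auto
  then show "(\<lambda>(i, j). F $ i $ j * x ^ i * y ^ j) summable_on UNIV"
    by (rule abs_summable_summable)
qed

lemma Suc_le_two_power: "real (Suc n) \<le> 2 ^ n"
  by (induction n) auto

lemma convergent2_bound_common:
  assumes "convergent2 F" "convergent2 G"
  obtains K where "K \<ge> 1" "\<And>i j. norm (F $ i $ j) \<le> K ^ (i + j + 1)"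
    "\<And>i j. norm (G $ i $ j) \<le> K ^ (i + j + 1)"
proof -
  obtain K where K: "K \<ge> 1" "\<And>i j. norm (F $ i $ j) \<le> K ^ (i + j + 1)"
    using convergent2_imp_bound[OF assms(1)] by blast
  obtain L where L: "L \<ge> 1" "\<And>i j. norm (G $ i $ j) \<le> L ^ (i + j + 1)"
    using convergent2_imp_bound[OF assms(2)] by blast
  have "norm (F $ i $ j) \<le> max K L ^ (i + j + 1)" for i j
    by (rule order.trans[OF K(2)]) (use K(1) in \<open>intro power_mono, auto\<close>)
  moreover have "norm (G $ i $ j) \<le> max K L ^ (i + j + 1)" for i j
    by (rule order.trans[OF L(2)]) (use L(1) in \<open>intro power_mono, auto\<close>)
  ultimately show ?thesis
    using K(1) that[of "max K L"] by auto
qed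

lemma convergent2_add:
  assumes "convergent2 F" "convergent2 G"
  shows "convergent2 (F + G)"
proof -
  obtain K where K: "K \<ge> 1" "\<And>i j. norm (F $ i $ j) \<le> K ^ (i + j + 1)"
    "\<And>i j. norm (G $ i $ j) \<le> K ^ (i + j + 1)"
    using convergent2_bound_common[OF assms] by blast
  show ?thesis
  proof (rule bound_imp_convergent2[where K = "2 * K"])
    fix i j
    have "norm ((F + G) $ i $ j) \<le> 2 * K ^ (i + j + 1)"
      using norm_triangle_mono[OF K(2) K(3), of i j i j] by simp
    also have "\<dots> \<le> 2 ^ (i + j + 1) * K ^ (i + j + 1)"
      using K(1) by (intro mult_right_mono) auto
    finally show "norm ((F + G) $ i $ j) \<le> (2 * K) ^ (i + j + 1)"
      by (simp only: power_mult_distrib)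
  qed (use K in auto)
qed

lemma convergent2_uminus: "convergent2 F \<Longrightarrow> convergent2 (- F)"
  by (simp add: convergent2_def case_prod_unfold summable_on_uminus)

lemma convergent2_const: "convergent2 (fps_const (fps_const c))"
  by (rule bound_imp_convergent2[where K = "max 1 (norm c)"]) auto

lemma convergent2_mult:
  assumes "convergent2 F" "convergent2 G"
  shows "convergent2 (F * G)"
proof -
  obtain K where K: "K \<ge> 1" "\<And>i j. norm (F $ i $ j) \<le> K ^ (i + j + 1)"
    "\<And>i j. norm (G $ i $ j) \<le> K ^ (i + j + 1)"
    using convergent2_bound_common[OF assms] by blast
  show ?thesis
  proof (rule bound_imp_convergent2[where K = "2 * K ^ 2"])
    fix i j
    have "norm ((F * G) $ i $ j) =
        norm (\<Sum>k=0..i. \<Sum>l=0..j. F $ k $ l * G $ (i - k) $ (j - l))"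
      by (simp add: fps_mult_nth fps_sum_nth)
    also have "\<dots> \<le> (\<Sum>k=0..i. \<Sum>l=0..j. K ^ (i + j + 2))"
    proof (intro sum_norm_le)
      fix k l assume kl: "k \<in> {0..i}" "l \<in> {0..j}"
      have "norm (F $ k $ l * G $ (i - k) $ (j - l)) \<le>
          K ^ (k + l + 1) * K ^ ((i - k) + (j - l) + 1)"
        unfolding norm_mult using K by (intro mult_mono) auto
      also have "\<dots> = K ^ (i + j + 2)"
        using kl by (simp flip: power_add)
      finally show "norm (F $ k $ l * G $ (i - k) $ (j - l)) \<le> K ^ (i + j + 2)" .
    qed
    also have "\<dots> = real (Suc i) * real (Suc j) * K ^ (i + j + 2)"
      by simp
    also have "\<dots> \<le> (2 ^ i * 2 ^ j) * K ^ (2 * (i + j + 1))"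
      using K(1) by (intro mult_mono Suc_le_two_power power_increasing) auto
    also have "\<dots> \<le> 2 ^ (i + j + 1) * K ^ (2 * (i + j + 1))"
      using K(1) by (intro mult_right_mono) (auto simp: power_add)
    also have "\<dots> = (2 * K ^ 2) ^ (i + j + 1)"
      by (simp only: power_mult_distrib power_mult)
    finally show "norm ((F * G) $ i $ j) \<le> (2 * K ^ 2) ^ (i + j + 1)" .
  next
    show "1 \<le> 2 * K ^ 2"
      using one_le_power[OF K(1), of 2] by linarith
  qed
qed

lemma convergent2_shift:
  assumes "convergent2 F"
    and "\<And>i j. norm (G $ i $ j) \<le> 2 ^ (i + j) * norm (F $ (i + a) $ (j + b))" and "a + b = 1"
  shows "convergent2 G"
proof -
  obtain K where K: "K \<ge> 1" "\<And>i j. norm (F $ i $ j) \<le> K ^ (i + j + 1)"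
    using convergent2_imp_bound[OF assms(1)] by blast
  show ?thesis
  proof (rule bound_imp_convergent2[where K = "2 * K ^ 2"])
    fix i j
    have "norm (G $ i $ j) \<le> 2 ^ (i + j) * norm (F $ (i + a) $ (j + b))"
      by (rule assms)
    also have "\<dots> \<le> 2 ^ (i + j + 1) * K ^ (2 * (i + j + 1))"
    proof (intro mult_mono)
      have "norm (F $ (i + a) $ (j + b)) \<le> K ^ (i + a + (j + b) + 1)"
        by (rule K)
      also have "\<dots> \<le> K ^ (2 * (i + j + 1))"
        using K(1) assms(3) by (intro power_increasing) auto
      finally show "norm (F $ (i + a) $ (j + b)) \<le> K ^ (2 * (i + j + 1))" .
    qed auto
    also have "\<dots> = (2 * K ^ 2) ^ (i + j + 1)"
      by (simp only: power_mult_distrib power_mult)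
    finally show "norm (G $ i $ j) \<le> (2 * K ^ 2) ^ (i + j + 1)" .
  next
    show "1 \<le> 2 * K ^ 2"
      using one_le_power[OF K(1), of 2] by linarith
  qed
qed

lemma Suc_mult_norm_le:
  "norm (of_nat (Suc n) * z) \<le> 2 ^ (n + m) * norm (z :: complex)"
  "norm (of_nat (Suc n) * z) \<le> 2 ^ (m + n) * norm (z :: complex)"
proof -
  have "real (Suc n) \<le> 2 ^ n" by (rule Suc_le_two_power)
  also have "(2::real) ^ n \<le> 2 ^ (n + m)" by (rule power_increasing) auto
  finally have "norm (of_nat (Suc n) :: complex) * norm z \<le> 2 ^ (n + m) * norm z"
    by (intro mult_right_mono) (auto simp del: of_nat_Suc)
  then show "norm (of_nat (Suc n) * z) \<le> 2 ^ (n + m) * norm z"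
    by (simp only: norm_mult)
  then show "norm (of_nat (Suc n) * z) \<le> 2 ^ (m + n) * norm z"
    by (simp only: add.commute)
qed

lemma fps_nth_of_nat_mult: "(of_nat n * f) $ j = of_nat n * (f $ j :: complex)"
  by (metis fps_mult_left_const_nth fps_of_nat)

lemma convergent2_deriv_outer: "convergent2 F \<Longrightarrow> convergent2 (fps_deriv F)"
  by (rule convergent2_shift[where F = F and a = 1 and b = 0])
     (simp_all add: fps_nth_of_nat_mult Suc_mult_norm_le(1) del: of_nat_Suc of_nat_add
       flip: of_nat_Suc)

lemma convergent2_deriv_inner: "convergent2 F \<Longrightarrow> convergent2 (Abs_fps (\<lambda>i. fps_deriv (F $ i)))"
  by (rule convergent2_shift[where F = F and a = 0 and b = 1])
     (simp_all add: Suc_mult_norm_le(2) del: of_nat_Suc of_nat_add flip: of_nat_Suc)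

typedef cps2 = "{F. convergent2 F}"
  morphisms fps_of_cps2 Abs_cps2
  using convergent2_const[of 0] by blast

setup_lifting type_definition_cps2

instantiation cps2 :: idom
begin

lift_definition zero_cps2 :: cps2 is 0
  using convergent2_const[of 0] by simp
lift_definition one_cps2 :: cps2 is 1
  using convergent2_const[of 1] by simp
lift_definition plus_cps2 :: "cps2 \<Rightarrow> cps2 \<Rightarrow> cps2" is "(+)"
  by (rule convergent2_add)
lift_definition uminus_cps2 :: "cps2 \<Rightarrow> cps2" is uminus
  by (rule convergent2_uminus)
lift_definition minus_cps2 :: "cps2 \<Rightarrow> cps2 \<Rightarrow> cps2" is "(-)"
  using convergent2_add convergent2_uminus by fastforce
lift_definition times_cps2 :: "cps2 \<Rightarrow> cps2 \<Rightarrow> cps2" is "(*)"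
  by (rule convergent2_mult)

instance
  by standard (transfer, simp add: algebra_simps)+

end

text \<open>The predicate \<^const>\<open>coprime\<close> of the library lives in a class that carries a partial division;
  the value outside exact divisibility is irrelevant.\<close>

instantiation cps2 :: idom_divide
begin

definition divide_cps2 :: "cps2 \<Rightarrow> cps2 \<Rightarrow> cps2" where
  "divide_cps2 a b = (if b \<noteq> 0 \<and> b dvd a then THE c. a = c * b else 0)"

instance
  by standard (auto simp: divide_cps2_def)

end

instance cps2 :: algebraic_semidom ..

lift_definition const_cps2 :: "complex \<Rightarrow> cps2" is "\<lambda>c. fps_const (fps_const c)"
  by (rule convergent2_const)

lift_definition dx :: "cps2 \<Rightarrow> cps2" is fps_deriv
  by (rule convergent2_deriv_outer)

lift_definition dy :: "cps2 \<Rightarrow> cps2" is "\<lambda>F. Abs_fps (\<lambda>i. fps_deriv (F $ i))"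
  by (rule convergent2_deriv_inner)

text \<open>The holomorphic function defined by \<open>F\<close>; only meaningful near the origin, since
  \<^const>\<open>infsum\<close> is \<open>0\<close> where the series diverges.\<close>

definition eval_cps2 :: "cps2 \<Rightarrow> complex \<times> complex \<Rightarrow> complex" where
  "eval_cps2 F = (\<lambda>(x, y). \<Sum>\<^sub>\<infinity>(i, j)\<in>UNIV. fps_of_cps2 F $ i $ j * x ^ i * y ^ j)"

definition scale_cps2 :: "complex \<Rightarrow> cps2 \<Rightarrow> cps2" where
  "scale_cps2 c F = const_cps2 c * F"

global_interpretation cps2: vector_space_quotient scale_cps2
  defines cps2_quot_dim = cps2.quot_dim
  unfolding scale_cps2_def
  by standard
    (transfer, simp add: algebra_simps flip: fps_const_add fps_const_mult)+

global_interpretation cps2_ideal: module "(*) :: cps2 \<Rightarrow> cps2 \<Rightarrow> cps2"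
  defines ideal_gen = cps2_ideal.span
  by standard (simp_all add: algebra_simps)

lemma ideal_gen_complex_subspace: "cps2.subspace (ideal_gen S)"
  unfolding cps2.subspace_def scale_cps2_def
  by (auto intro: cps2_ideal.span_zero cps2_ideal.span_add cps2_ideal.span_scale)


section \<open>The invariants\<close>

definition omega_x :: "cps2 \<Rightarrow> cps2 \<Rightarrow> cps2" where
  "omega_x f g = g * dx f - f * dx g"

definition omega_y :: "cps2 \<Rightarrow> cps2 \<Rightarrow> cps2" where
  "omega_y f g = g * dy f - f * dy g"

definition omega_isolated_singularity :: "cps2 \<Rightarrow> cps2 \<Rightarrow> bool" where
  "omega_isolated_singularity f g \<longleftrightarrow>
     (\<forall>\<^sub>F p in at (0, 0). \<not> (eval_cps2 (omega_x f g) p = 0 \<and> eval_cps2 (omega_y f g) p = 0))"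

text \<open>The curve \<open>C\<close> of the fibre is reduced iff its equation \<open>fiber \<alpha> \<beta> f g\<close> is
  \<^const>\<open>squarefree\<close> in the ring of convergent power series.\<close>

definition fiber :: "complex \<Rightarrow> complex \<Rightarrow> cps2 \<Rightarrow> cps2 \<Rightarrow> cps2" where
  "fiber \<alpha> \<beta> f g = const_cps2 \<alpha> * f + const_cps2 \<beta> * g"

definition tjurina :: "cps2 \<Rightarrow> enat" where
  "tjurina h = cps2_quot_dim UNIV (ideal_gen {h, dx h, dy h})"

definition tjurina_pair :: "complex \<Rightarrow> complex \<Rightarrow> cps2 \<Rightarrow> cps2 \<Rightarrow> enat" where
  "tjurina_pair \<alpha> \<beta> f g =
     cps2_quot_dim UNIV (ideal_gen {omega_x f g, omega_y f g, fiber \<alpha> \<beta> f g})"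

definition milnor_pair :: "cps2 \<Rightarrow> cps2 \<Rightarrow> enat" where
  "milnor_pair f g = cps2_quot_dim UNIV (ideal_gen {omega_x f g, omega_y f g})"

definition suwa :: "cps2 \<Rightarrow> cps2 \<Rightarrow> enat" where
  "suwa f g = cps2_quot_dim (ideal_gen {f, g}) (ideal_gen {omega_x f g, omega_y f g})"

lemma omega_ideal_subset: "ideal_gen {omega_x f g, omega_y f g} \<subseteq> ideal_gen {f, g}"
proof (rule cps2_ideal.span_minimal)
  have "g * a - f * b \<in> ideal_gen {f, g}" for a b
    using cps2_ideal.span_diff[OF cps2_ideal.span_scale[of g "{f, g}" a]
        cps2_ideal.span_scale[of f "{f, g}" b]]
    by (simp add: cps2_ideal.span_base mult.commute)
  then show "{omega_x f g, omega_y f g} \<subseteq> ideal_gen {f, g}"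
    by (simp add: omega_x_def omega_y_def)
qed (rule cps2_ideal.subspace_span)

end

theory Submission
  imports Defs "HOL-Computational_Algebra.Fundamental_Theorem_Algebra"
begin

no_notation vector_scalar_mult (infixl "*s" 70)

text \<open>Choose \<open>k = \<gamma> f + \<delta> g\<close> so that \<open>(h, k)\<close>, with \<open>h = \<alpha> f + \<beta> g\<close>, is an invertible linear
  change of \<open>(f, g)\<close>; this multiplies \<open>\<omega>\<close> by a nonzero constant and keeps the ideal \<open>(f, g)\<close>. Modulo \<open>h\<close>
  the coefficients of \<open>\<omega>\<close> are \<open>k h\<^sub>x\<close> and \<open>k h\<^sub>y\<close>. Hence \<open>\<mu>(f, g) - \<nu>(f, g) = dim \<O>/(h, k)\<close>, and
  \<open>\<tau>\<close> of the pair is \<open>dim \<O>/(h, k)\<close> plus \<open>dim (h, k)/(h, k h\<^sub>x, k h\<^sub>y)\<close>, where the second summand is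
  \<open>\<tau>(h)\<close> because \<open>k\<close> is not a zero divisor modulo \<open>h\<close>.

  All these dimensions are finite once \<open>\<mu>\<close> is, i.e. once two series \<open>p\<close>, \<open>q\<close> with an isolated common
  zero generate an ideal containing powers of \<open>x\<close> and \<open>y\<close>. By Weierstrass preparation \<open>p\<close> may be taken
  to be a monic polynomial of degree \<open>d\<close> in \<open>y\<close>. The powers \<open>1, q, \<dots>, q\<^sup>d\<close> are linearly dependent
  modulo \<open>p\<close> over the series in \<open>x\<close>, which gives \<open>p dvd q\<^sup>m (a + q w)\<close> with \<open>a \<noteq> 0\<close> a series in \<open>x\<close>;
  as \<open>q\<close> does not vanish at the zeros of \<open>p\<close>, the factor \<open>q\<^sup>m\<close> cancels and \<open>a \<in> (p, q)\<close>.\<close>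

section \<open>Linear algebra\<close>

context vector_space_quotient
begin

lemma ex_quot_basis:
  assumes W: "subspace W"
    and B: "finite B" "B \<subseteq> V" "\<And>v. v \<in> V \<Longrightarrow> \<exists>w\<in>span B. v - w \<in> W"
  shows "\<exists>C. quot_basis V W C"
proof -
  have "\<exists>u. v - (\<Sum>b\<in>B. u b *s b) \<in> W" if "v \<in> V" for v
    using B(3)[OF that] unfolding span_finite[OF B(1)] by blast
  with B(1,2) show ?thesis
  proof (induction B rule: finite_psubset_induct)
    case (psubset B)
    show ?case
    proof (cases "quot_basis V W B")
      case False
      then obtain u c where u: "(\<Sum>b\<in>B. u b *s b) \<in> W" "c \<in> B" "u c \<noteq> 0"
        using psubset.hyps psubset.prems unfolding quot_basis_def by blast
      show ?thesis
      proof (rule psubset.IH[of "B - {c}"])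
        fix v assume "v \<in> V"
        then obtain w where w: "v - (\<Sum>b\<in>B. w b *s b) \<in> W"
          using psubset.prems by blast
        \<comment> \<open>This multiple of the relation is the one that cancels the coefficient at
          \<open>c\<close>.\<close>
        define w' where "w' b = w b - w c / u c * u b" for b
        have "(v - (\<Sum>b\<in>B. w b *s b)) + (w c / u c) *s (\<Sum>b\<in>B. u b *s b) \<in> W"
          using W u w by (intro subspace_add subspace_scale)
        also have "(v - (\<Sum>b\<in>B. w b *s b)) + (w c / u c) *s (\<Sum>b\<in>B. u b *s b)
            = v - (\<Sum>b\<in>B. w' b *s b)"
          by (simp add: w'_def scale_left_diff_distrib sum_subtractf scale_sum_right)
        also have "(\<Sum>b\<in>B. w' b *s b) = (\<Sum>b\<in>B - {c}. w' b *s b)"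
          using u psubset.hyps by (intro sum.mono_neutral_right) (auto simp: w'_def)
        finally show "\<exists>u. v - (\<Sum>b\<in>B - {c}. u b *s b) \<in> W" by blast
      qed (use u psubset.prems in auto)
    qed blast
  qed
qed

text \<open>Reducing a relation first modulo \<open>V\<close> kills its coefficients on
  \<open>B\<close>; what remains lies in \<open>V\<close> and kills those on \<open>C\<close>. This
  gives additivity of dimension along a chain of ideals.\<close>

lemma quot_basis_Un:
  assumes V: "subspace V" and W: "subspace W" and "W \<subseteq> V" "V \<subseteq> U"
    and B: "quot_basis U V B" and C: "quot_basis V W C"
  shows "quot_basis U W (B \<union> C)" "card (B \<union> C) = card B + card C"
proof -
  have fin: "finite B" "finite C" and sub: "B \<subseteq> U" "C \<subseteq> V"
    and indB: "\<And>u. (\<Sum>b\<in>B. u b *s b) \<in> V \<Longrightarrow> \<forall>b\<in>B. u b = 0"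
    and indC: "\<And>u. (\<Sum>b\<in>C. u b *s b) \<in> W \<Longrightarrow> \<forall>b\<in>C. u b = 0"
    using B C by (auto simp: quot_basis_def)
  have disj: "B \<inter> C = {}"
  proof (rule ccontr)
    assume "B \<inter> C \<noteq> {}"
    then obtain b where b: "b \<in> B" "b \<in> C" by blast
    \<comment> \<open>The indicator of \<open>b\<close>: a common element would be a basis vector of
      U/V that is zero modulo \<open>V\<close>.\<close>
    define u where "u a = (if a = b then 1 else 0 :: 'a)" for a
    have "(\<Sum>a\<in>B. u a *s a) = (\<Sum>a\<in>{b}. u a *s a)"
      using fin b by (intro sum.mono_neutral_right) (auto simp: u_def)
    also have "\<dots> \<in> V" using b sub by (auto simp: u_def)
    finally have "u b = 0" using indB[of u] b by blast
    then show False by (simp add: u_def)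
  qed
  have split: "(\<Sum>b\<in>B \<union> C. u b *s b) = (\<Sum>b\<in>B. u b *s b) + (\<Sum>b\<in>C. u b *s b)" for u
    using fin disj by (rule sum.union_disjoint)
  have CV: "(\<Sum>b\<in>C. u b *s b) \<in> V" for u
    using sub by (intro subspace_sum subspace_scale V) auto
  show "quot_basis U W (B \<union> C)"
    unfolding quot_basis_def
  proof (intro conjI allI impI ballI)
    show "B \<union> C \<subseteq> U" using sub assms by blast
  next
    fix u c assume u: "(\<Sum>b\<in>B \<union> C. u b *s b) \<in> W" and c: "c \<in> B \<union> C"
    have "(\<Sum>b\<in>B. u b *s b) \<in> V"
      using subspace_diff[OF V _ CV[of u], of "\<Sum>b\<in>B \<union> C. u b *s b"] u \<open>W \<subseteq> V\<close>
      by (auto simp: split)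
    then have uB: "\<forall>b\<in>B. u b = 0" by (rule indB)
    with u have "(\<Sum>b\<in>C. u b *s b) \<in> W" by (simp add: split)
    then have "\<forall>b\<in>C. u b = 0" by (rule indC)
    then show "u c = 0" using uB c by blast
  next
    fix v assume "v \<in> U"
    then obtain u where u: "v - (\<Sum>b\<in>B. u b *s b) \<in> V"
      using B by (auto simp: quot_basis_def)
    then obtain w where w: "v - (\<Sum>b\<in>B. u b *s b) - (\<Sum>b\<in>C. w b *s b) \<in> W"
      using C unfolding quot_basis_def by blast
    define x where "x b = (if b \<in> B then u b else w b)" for b
    have "(\<Sum>b\<in>C. x b *s b) = (\<Sum>b\<in>C. w b *s b)"
      using disj by (intro sum.cong) (auto simp: x_def)
    then have "v - (\<Sum>b\<in>B \<union> C. x b *s b) \<in> W"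
      using w by (simp add: split x_def algebra_simps)
    then show "\<exists>u. v - (\<Sum>b\<in>B \<union> C. u b *s b) \<in> W" by blast
  qed (use fin in auto)
  show "card (B \<union> C) = card B + card C"
    using fin disj by (rule card_Un_disjoint)
qed

text \<open>The map induced from V/W to V'/W' is injective by \<open>ker\<close> and onto by
  \<open>surj\<close>, so it carries bases to bases. It is used for multiplication by a fixed
  series.\<close>

lemma quot_basis_image:
  assumes lin: "\<And>x y. \<phi> (x + y) = \<phi> x + \<phi> y" "\<And>c x. \<phi> (c *s x) = c *s \<phi> x"
    and V: "subspace V" and W': "subspace W'" and im: "\<phi> ` V \<subseteq> V'"
    and ker: "\<And>v. v \<in> V \<Longrightarrow> \<phi> v \<in> W' \<longleftrightarrow> v \<in> W"
    and surj: "\<And>v'. v' \<in> V' \<Longrightarrow> \<exists>v\<in>V. v' - \<phi> v \<in> W'"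
    and B: "quot_basis V W B"
  shows "quot_basis V' W' (\<phi> ` B)" "card (\<phi> ` B) = card B"
proof -
  have fin: "finite B" and sub: "B \<subseteq> V"
    and ind: "\<And>u. (\<Sum>b\<in>B. u b *s b) \<in> W \<Longrightarrow> \<forall>b\<in>B. u b = 0"
    using B by (auto simp: quot_basis_def)
  have BV: "(\<Sum>b\<in>B. u b *s b) \<in> V" for u
    using sub by (intro subspace_sum subspace_scale V) auto
  have zero: "\<phi> 0 = 0" using lin(1)[of 0 0] by simp
  have sum: "\<phi> (\<Sum>b\<in>A. u b *s b) = (\<Sum>b\<in>A. u b *s \<phi> b)" for u A
    by (induction A rule: infinite_finite_induct) (simp_all add: zero lin)
  have inj: "inj_on \<phi> B"
  proof (rule inj_onI, rule ccontr)
    fix c d assume cd: "c \<in> B" "d \<in> B" "\<phi> c = \<phi> d" "c \<noteq> d"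
    \<comment> \<open>The relation c - d, which the linear map sends to zero.\<close>
    define u where "u e = (if e = c then 1 else if e = d then - 1 else (0::'a))" for e
    have "(\<Sum>e\<in>B. u e *s \<phi> e) = (\<Sum>e\<in>{c,d}. u e *s \<phi> e)"
      using cd fin by (intro sum.mono_neutral_right) (auto simp: u_def)
    also have "\<dots> = 0" using cd by (simp add: u_def)
    finally have "(\<Sum>e\<in>B. u e *s e) \<in> W"
      using ker[OF BV[of u]] subspace_0[OF W'] by (simp add: sum)
    then have "u c = 0" using ind[of u] cd by blast
    then show False by (simp add: u_def)
  qed
  show "card (\<phi> ` B) = card B" by (rule card_image[OF inj])
  show "quot_basis V' W' (\<phi> ` B)"
    unfolding quot_basis_def
  proof (intro conjI allI impI)
    show "\<phi> ` B \<subseteq> V'" using im sub by blast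
  next
    fix u assume "(\<Sum>b\<in>\<phi> ` B. u b *s b) \<in> W'"
    then have "\<phi> (\<Sum>b\<in>B. u (\<phi> b) *s b) \<in> W'"
      by (simp add: sum.reindex[OF inj] sum)
    then have "\<forall>b\<in>B. u (\<phi> b) = 0"
      using ind[of "\<lambda>b. u (\<phi> b)"] ker[OF BV[of "\<lambda>b. u (\<phi> b)"]] by blast
    then show "\<forall>b\<in>\<phi> ` B. u b = 0" by blast
  next
    show "\<forall>v'\<in>V'. \<exists>u. v' - (\<Sum>b\<in>\<phi> ` B. u b *s b) \<in> W'"
    proof
      fix v' assume "v' \<in> V'"
      then obtain v where v: "v \<in> V" "v' - \<phi> v \<in> W'" using surj by blast
      obtain u where u: "v - (\<Sum>b\<in>B. u b *s b) \<in> W"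
        using v B by (auto simp: quot_basis_def)
      have "\<phi> (v - (\<Sum>b\<in>B. u b *s b)) \<in> W'"
        using u ker[OF subspace_diff[OF V v(1) BV[of u]]] by blast
      from subspace_add[OF W' v(2) this] 
      have "v' - (\<phi> v - \<phi> (v - (\<Sum>b\<in>B. u b *s b))) \<in> W'" by (simp add: algebra_simps)
      also have "\<phi> v - \<phi> (v - (\<Sum>b\<in>B. u b *s b)) = \<phi> (\<Sum>b\<in>B. u b *s b)"
        using lin(1)[of "v - (\<Sum>b\<in>B. u b *s b)" "\<Sum>b\<in>B. u b *s b"] by (simp add: algebra_simps)
      also have "\<dots> = (\<Sum>b\<in>\<phi> ` B. u (the_inv_into B \<phi> b) *s b)"
        by (simp add: sum.reindex[OF inj] sum the_inv_into_f_f[OF inj])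
      finally show "\<exists>u. v' - (\<Sum>b\<in>\<phi> ` B. u b *s b) \<in> W'"
        by (rule exI[of _ "\<lambda>b. u (the_inv_into B \<phi> b)"])
    qed
  qed (use fin in auto)
qed

end

text \<open>Fraction-free Gaussian elimination: more vectors than coordinates forces a nontrivial
  relation, and since nothing is divided its coefficients stay in the subring \<open>S\<close>.
  Later \<open>S\<close> consists of the series in x alone.\<close>

lemma ex_linear_relation:
  fixes v :: "'b \<Rightarrow> nat \<Rightarrow> 'a :: idom"
  assumes S: "0 \<in> S" "1 \<in> S" "\<And>a b. a \<in> S \<Longrightarrow> b \<in> S \<Longrightarrow> a - b \<in> S"
      "\<And>a b. a \<in> S \<Longrightarrow> b \<in> S \<Longrightarrow> a * b \<in> S"
    and "finite A" "d < card A" "\<And>i j. i \<in> A \<Longrightarrow> j < d \<Longrightarrow> v i j \<in> S"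
  shows "\<exists>a. (\<forall>i\<in>A. a i \<in> S) \<and> (\<exists>i\<in>A. a i \<noteq> 0) \<and> (\<forall>j<d. (\<Sum>i\<in>A. a i * v i j) = 0)"
  using assms(5-)
proof (induction d arbitrary: A v)
  case 0
  then have "A \<noteq> {}" by auto
  then show ?case using S(2) by (intro exI[of _ "\<lambda>_. 1"]) auto
next
  case (Suc d)
  have sumS: "sum f T \<in> S" if "\<And>i. i \<in> T \<Longrightarrow> f i \<in> S" for f and T :: "'b set"
    using that
  proof (induction T rule: infinite_finite_induct)
    case (insert x F)
    have "f x - (0 - sum f F) \<in> S"
      using insert.IH insert.prems by (intro S) auto
    then show ?case using insert.hyps by simp
  qed (use S(1) in auto)
  show ?case
  proof (cases "\<forall>i\<in>A. v i d = 0")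
    case True
    obtain a where "\<forall>i\<in>A. a i \<in> S" "\<exists>i\<in>A. a i \<noteq> 0" "\<forall>j<d. (\<Sum>i\<in>A. a i * v i j) = 0"
      using Suc.IH[of A v] Suc.prems by auto
    then show ?thesis using True by (intro exI[of _ a]) (auto simp: less_Suc_eq)
  next
    case False
    then obtain k where k: "k \<in> A" "v k d \<noteq> 0" by blast
    \<comment> \<open>Cross-multiplication with the pivot \<open>v k d\<close> makes the last
      coordinate of every \<open>w i\<close> vanish.\<close>
    define w where "w i j = v k d * v i j - v i d * v k j" for i j
    have "\<exists>a. (\<forall>i\<in>A - {k}. a i \<in> S) \<and> (\<exists>i\<in>A - {k}. a i \<noteq> 0) \<and>
        (\<forall>j<d. (\<Sum>i\<in>A - {k}. a i * w i j) = 0)"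
    proof (rule Suc.IH)
      show "w i j \<in> S" if "i \<in> A - {k}" "j < d" for i j
        unfolding w_def using that k Suc.prems by (intro S) auto
    qed (use k Suc.prems in auto)
    then obtain a where a: "\<forall>i\<in>A - {k}. a i \<in> S" "\<exists>i\<in>A - {k}. a i \<noteq> 0"
      "\<forall>j<d. (\<Sum>i\<in>A - {k}. a i * w i j) = 0" by blast
    define s where "s = (\<Sum>i\<in>A - {k}. a i * v i d)"
    \<comment> \<open>The coefficient at \<open>k\<close> collects the multiples of
      \<open>v k\<close> that were subtracted in forming the \<open>w i\<close>.\<close>
    define b where "b i = (if i = k then 0 - s else v k d * a i)" for i
    have eq: "(\<Sum>i\<in>A. b i * v i j) = (\<Sum>i\<in>A - {k}. a i * w i j)" for j
    proof -
      have "(\<Sum>i\<in>A. b i * v i j) = b k * v k j + (\<Sum>i\<in>A - {k}. b i * v i j)"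
        using k Suc.prems by (intro sum.remove) auto
      also have "(\<Sum>i\<in>A - {k}. b i * v i j) = (\<Sum>i\<in>A - {k}. v k d * a i * v i j)"
        by (intro sum.cong) (auto simp: b_def)
      also have "b k * v k j = - (\<Sum>i\<in>A - {k}. a i * v i d * v k j)"
        by (simp add: b_def s_def sum_distrib_right)
      finally show ?thesis
        by (simp add: w_def sum_subtractf algebra_simps)
    qed
    show ?thesis
    proof (intro exI[of _ b] conjI allI impI)
      have "s \<in> S" unfolding s_def using a Suc.prems by (intro sumS S) auto
      then show "\<forall>i\<in>A. b i \<in> S"
        unfolding b_def using a k Suc.prems by (auto simp del: diff_0 intro!: S)
      show "\<exists>i\<in>A. b i \<noteq> 0" using a k by (auto simp: b_def)
      fix j assume "j < Suc d"
      then show "(\<Sum>i\<in>A. b i * v i j) = 0"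
        using a(3) by (auto simp: eq less_Suc_eq) (simp add: w_def)
    qed
  qed
qed

section \<open>Weierstrass division and preparation\<close>

lemma convergent2I:
  assumes "\<And>i j. norm (F $ i $ j) \<le> A * B ^ i * C ^ j" "A \<ge> 0" "B \<ge> 0" "C \<ge> 0"
  shows "convergent2 F"
proof (rule bound_imp_convergent2[where K = "max 1 (max A (max B C))"])
  fix i j
  define K where "K = max 1 (max A (max B C))"
  have "norm (F $ i $ j) \<le> A * B ^ i * C ^ j" by (rule assms)
  also have "\<dots> \<le> K * K ^ i * K ^ j"
    using assms by (intro mult_mono power_mono) (auto simp: K_def)
  finally show "norm (F $ i $ j) \<le> K ^ (i + j + 1)"
    by (simp add: power_add mult_ac)
qed auto

lemma geometric_sum_le:
  fixes r :: real
  assumes "r \<ge> 2"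
  shows "(\<Sum>k<n. r ^ k) * r \<le> 2 * r ^ n"
proof (induction n)
  case (Suc n)
  have "2 * r ^ n \<le> r * r ^ n" using assms by (intro mult_right_mono) auto
  with Suc show ?case by (simp add: algebra_simps)
qed simp

lemma norm_fps_inverse_le:
  fixes e :: "complex fps"
  assumes "e $ 0 \<noteq> 0" "K \<ge> 1" "\<And>n. norm (e $ n) \<le> K ^ (n + 1)"
  obtains A B where "A \<ge> 0" "B \<ge> 0" "\<And>n. norm (inverse e $ n) \<le> A * B ^ n"
proof -
  define c where "c = norm (inverse (e $ 0))"
  \<comment> \<open>Large enough that r \<ge> 2, as the geometric sum bound requires, and 2 c K
    \<le> r, so that the convolution sum in the recursion for the inverse is absorbed.\<close>
  define r where "r = 2 + 2 * c * K"
  have c: "c \<ge> 0" by (simp add: c_def)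
  have r: "r \<ge> 2" "2 * c * K \<le> r" using c assms by (auto simp: r_def)
  have "norm (inverse e $ n) \<le> c * (K * r) ^ n" for n
  proof (induction n rule: less_induct)
    case (less n)
    show ?case
    proof (cases n)
      case 0
      then show ?thesis by (simp add: c_def)
    next
      case (Suc m)
      have "inverse e $ n = - inverse (e $ 0) * (\<Sum>i=1..n. e $ i * inverse e $ (n - i))"
        using Suc by (simp add: fps_inverse_def)
      also have "(\<Sum>i=1..n. e $ i * inverse e $ (n - i)) = (\<Sum>k<n. e $ (n - k) * inverse e $ k)"
        by (rule sum.reindex_bij_witness[of _ "\<lambda>k. n - k" "\<lambda>k. n - k"]) auto
      finally have "norm (inverse e $ n) = c * norm (\<Sum>k<n. e $ (n - k) * inverse e $ k)"
        by (simp add: c_def norm_mult)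
      also have "norm (\<Sum>k<n. e $ (n - k) * inverse e $ k) \<le> (\<Sum>k<n. c * K * K ^ n * r ^ k)"
      proof (rule sum_norm_le)
        fix k assume k: "k \<in> {..<n}"
        have "norm (e $ (n - k) * inverse e $ k) \<le> K ^ (n - k + 1) * (c * (K * r) ^ k)"
          unfolding norm_mult using k less assms by (intro mult_mono) auto
        also have "\<dots> = c * K * (K ^ (n - k) * K ^ k) * r ^ k"
          by (simp add: power_mult_distrib)
        also have "K ^ (n - k) * K ^ k = K ^ n"
          using k by (simp flip: power_add)
        finally show "norm (e $ (n - k) * inverse e $ k) \<le> c * K * K ^ n * r ^ k" .
      qed
      also have "c * (\<Sum>k<n. c * K * K ^ n * r ^ k) = c * K ^ n * (c * K * (\<Sum>k<n. r ^ k))"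
        by (simp add: sum_distrib_left mult_ac)
      also have "\<dots> \<le> c * K ^ n * r ^ n"
      proof (intro mult_left_mono)
        have "2 * (c * K * (\<Sum>k<n. r ^ k)) = (2 * c * K) * (\<Sum>k<n. r ^ k)" by simp
        also have "\<dots> \<le> r * (\<Sum>k<n. r ^ k)"
          using r by (intro mult_right_mono sum_nonneg) auto
        also have "\<dots> \<le> 2 * r ^ n" using geometric_sum_le[OF r(1), of n] by (simp add: mult.commute)
        finally show "c * K * (\<Sum>k<n. r ^ k) \<le> r ^ n" by simp
      qed (use c assms in auto)
      finally show ?thesis using c by (simp add: power_mult_distrib mult_left_mono)
    qed
  qed
  then show thesis using that c r assms by (meson mult_nonneg_nonneg order.trans zero_le_one zero_le_numeral)
qed

lemma convergent2_fps_const_inverse: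
  assumes "convergent2 F" "F $ 0 $ 0 \<noteq> 0"
  shows "convergent2 (fps_const (inverse (F $ 0)))"
proof -
  obtain K where K: "K \<ge> 1" "\<And>i j. norm (F $ i $ j) \<le> K ^ (i + j + 1)"
    using convergent2_imp_bound[OF assms(1)] by blast
  obtain A B where AB: "A \<ge> 0" "B \<ge> 0" "\<And>n. norm (inverse (F $ 0) $ n) \<le> A * B ^ n"
    using norm_fps_inverse_le[OF assms(2) K(1)] K(2)[of 0] by auto
  show ?thesis
    by (rule convergent2I[of _ A 1 B]) (use AB in auto)
qed

section \<open>The quotient in Weierstrass division and its convergence\<close>

fun wdiv_quot :: "nat \<Rightarrow> complex fps fps \<Rightarrow> complex fps fps \<Rightarrow> nat \<Rightarrow> complex fps" where
  "wdiv_quot d H F i =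
     fps_shift d (F $ i + (\<Sum>k<i. H $ (i - Suc k) * wdiv_quot d H F k))"

declare wdiv_quot.simps [simp del]

text \<open>Strong induction on the exponent of x keeps a bound that is geometric in both indices.
  Each recursion step is allowed to lose a constant factor, which the ratio \<open>K * r\<close> in
  the x-direction pays for.\<close>

lemma convergent2_wdiv_quot:
  assumes "convergent2 F" "convergent2 H"
  shows "convergent2 (Abs_fps (wdiv_quot d H F))"
proof -
  obtain K where K: "K \<ge> 1" "\<And>i j. norm (F $ i $ j) \<le> K ^ (i + j + 1)"
    "\<And>i j. norm (H $ i $ j) \<le> K ^ (i + j + 1)"
    using convergent2_bound_common[OF assms] by blast
  \<comment> \<open>\<open>C\<close> = 2 K turns the convolution in y into a geometric sum of ratio
    2; the factor C^d in \<open>r\<close> pays for the shift by y^d; \<open>A\<close> is chosen so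
    that \<open>F\<close> and the recursive terms each contribute at most half of the bound.\<close>
  define C where "C = 2 * K"
  define r where "r = 8 * C ^ d"
  define A where "A = 2 * K ^ (d + 1)"
  have C: "C \<ge> 1" using K by (simp add: C_def)
  have r: "r \<ge> 2" unfolding r_def using one_le_power[OF C, of d] by linarith
  have A: "A \<ge> 0" using K by (simp add: A_def)
  have bound: "norm (wdiv_quot d H F i $ j) \<le> A * (K * r) ^ i * C ^ j" for i j
  proof (induction i arbitrary: j rule: less_induct)
    case (less i)
    define n where "n = j + d"
    have t: "norm ((H $ (i - Suc k) * wdiv_quot d H F k) $ n)
        \<le> 2 * A * C ^ n * K ^ i * r ^ k" if k: "k < i" for k
    proof -
      have "norm ((H $ (i - Suc k) * wdiv_quot d H F k) $ n)
          = norm (\<Sum>l\<le>n. H $ (i - Suc k) $ (n - l) * wdiv_quot d H F k $ l)"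
        by (subst mult.commute) (simp add: fps_mult_nth mult.commute atMost_atLeast0)
      also have "\<dots> \<le> (\<Sum>l\<le>n. A * K ^ i * r ^ k * K ^ n * 2 ^ l)"
      proof (rule sum_norm_le)
        fix l assume l: "l \<in> {..n}"
        have "norm (H $ (i - Suc k) $ (n - l) * wdiv_quot d H F k $ l) \<le>
            K ^ (i - Suc k + (n - l) + 1) * (A * (K * r) ^ k * C ^ l)"
          unfolding norm_mult by (intro mult_mono less K) (use k K in auto)
        also have "K ^ (i - Suc k + (n - l) + 1) = K ^ (i - k) * K ^ (n - l)"
          using k by (simp flip: power_add add: Suc_diff_Suc)
        also have "K ^ (i - k) * K ^ (n - l) * (A * (K * r) ^ k * C ^ l) =
            A * (K ^ (i - k) * K ^ k) * r ^ k * (K ^ (n - l) * K ^ l) * 2 ^ l"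
          by (simp add: C_def power_mult_distrib mult_ac)
        also have "K ^ (i - k) * K ^ k = K ^ i" using k by (simp flip: power_add)
        also have "K ^ (n - l) * K ^ l = K ^ n" using l by (simp flip: power_add)
        finally show "norm (H $ (i - Suc k) $ (n - l) * wdiv_quot d H F k $ l)
            \<le> A * K ^ i * r ^ k * K ^ n * 2 ^ l" .
      qed
      also have "\<dots> = A * K ^ i * r ^ k * K ^ n * (\<Sum>l\<le>n. 2 ^ l)"
        by (simp add: sum_distrib_left)
      also have "\<dots> \<le> A * K ^ i * r ^ k * K ^ n * (2 * 2 ^ n)"
        using geometric_sum_le[of 2 "Suc n"] A K r
        by (intro mult_left_mono mult_nonneg_nonneg) (auto simp: lessThan_Suc_atMost)
      finally show ?thesis by (simp add: C_def power_mult_distrib mult_ac)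
    qed
    have "norm (wdiv_quot d H F i $ j)
        = norm (F $ i $ n + (\<Sum>k<i. (H $ (i - Suc k) * wdiv_quot d H F k) $ n))"
      by (subst wdiv_quot.simps) (simp add: n_def fps_sum_nth)
    also have "\<dots> \<le> K ^ (i + n + 1) + (\<Sum>k<i. 2 * A * C ^ n * K ^ i * r ^ k)"
      using t K by (intro norm_triangle_mono sum_norm_le) auto
    also have "K ^ (i + n + 1) \<le> A / 2 * (K * r) ^ i * C ^ j"
    proof -
      have "K ^ (i + n + 1) = A / 2 * K ^ i * K ^ j"
        by (simp add: A_def n_def power_add)
      also have "\<dots> \<le> A / 2 * (K * r) ^ i * C ^ j"
        using A K r by (intro mult_mono power_mono) (auto simp: C_def)
      finally show ?thesis .
    qed
    also have "(\<Sum>k<i. 2 * A * C ^ n * K ^ i * r ^ k) = A / 4 * C ^ j * K ^ i * ((\<Sum>k<i. r ^ k) * r)"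
      by (simp add: sum_distrib_left sum_distrib_right n_def power_add r_def mult_ac)
    also have "\<dots> \<le> A / 4 * C ^ j * K ^ i * (2 * r ^ i)"
      using A C K r by (intro mult_left_mono geometric_sum_le mult_nonneg_nonneg) auto
    finally show ?case by (simp add: power_mult_distrib mult_ac)
  qed
  show ?thesis
    by (rule convergent2I[of _ A "K * r" C]) (use bound A C K r in auto)
qed

lemma fps_shift_cutoff_eq: "fps_X ^ d * fps_shift d G + fps_cutoff d G = (G :: complex fps)"
  using fps_shift_cutoff[of d G] by (simp add: mult.commute)

text \<open>The quotient by \<open>y\<^sup>d - x H\<close> is the fixed point of \<open>Q \<mapsto> (F + x H Q) div y\<^sup>d\<close>,
  which determines the coefficients of \<open>x\<^sup>i\<close> in \<open>Q\<close> one after the other.\<close>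

lemma weierstrass_division_fps:
  assumes "convergent2 F" "convergent2 H"
  obtains Q R where "convergent2 Q" "F = Q * (fps_const (fps_X ^ d) - fps_X * H) + R"
    "\<And>i j. d \<le> j \<Longrightarrow> R $ i $ j = 0" "Q $ 0 = fps_shift d (F $ 0)" "R $ 0 = fps_cutoff d (F $ 0)"
proof -
  define Q where "Q = Abs_fps (wdiv_quot d H F)"
  define G where "G i = F $ i + (\<Sum>k<i. H $ (i - Suc k) * Q $ k)" for i
  define R where "R = Abs_fps (\<lambda>i. fps_cutoff d (G i))"
  have Qi: "Q $ i = fps_shift d (G i)" for i
    unfolding Q_def G_def by (simp add: wdiv_quot.simps[of d H F i])
  have XHQ: "(fps_X * (H * Q)) $ i = (\<Sum>k<i. H $ (i - Suc k) * Q $ k)" for i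
  proof (cases i)
    case (Suc m)
    have "(H * Q) $ m = (\<Sum>k=0..m. Q $ k * H $ (m - k))"
      by (subst mult.commute) (simp add: fps_mult_nth)
    then show ?thesis
      using Suc by (simp add: lessThan_Suc_atMost atMost_atLeast0 mult.commute)
  qed simp
  have "F = Q * (fps_const (fps_X ^ d) - fps_X * H) + R"
  proof (rule fps_ext)
    fix i
    have "Q * (fps_const (fps_X ^ d) - fps_X * H) + R
        = fps_const (fps_X ^ d) * Q - fps_X * (H * Q) + R"
      by (simp add: algebra_simps)
    then have "(Q * (fps_const (fps_X ^ d) - fps_X * H) + R) $ i
        = (fps_X ^ d * Q $ i + R $ i) - (fps_X * (H * Q)) $ i"
      by (simp only: fps_add_nth fps_sub_nth fps_mult_left_const_nth add_diff_eq diff_add_eq)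
    also have "\<dots> = F $ i"
    proof -
      have "fps_X ^ d * Q $ i + R $ i = G i" by (simp add: R_def Qi fps_shift_cutoff_eq)
      then show ?thesis by (simp only: XHQ) (simp add: G_def)
    qed
    finally show "F $ i = (Q * (fps_const (fps_X ^ d) - fps_X * H) + R) $ i" by simp
  qed
  moreover have "convergent2 Q"
    unfolding Q_def using assms by (rule convergent2_wdiv_quot)
  moreover have "G 0 = F $ 0" by (simp add: G_def)
  ultimately show thesis
    by (intro that[of Q R]) (simp_all add: R_def Qi)
qed

section \<open>The coordinates, divisibility by x, units and preparation\<close>

lift_definition cps2_X :: cps2 is fps_X
  by (rule convergent2I[of _ 1 1 1]) (auto simp: fps_X_def)

lift_definition cps2_Y :: cps2 is "fps_const fps_X"
  by (rule convergent2I[of _ 1 1 1]) (auto simp: fps_X_def)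

text \<open>The possible remainders of a Weierstrass division. The degree bound is strict, so
  \<open>d\<close> = 0 leaves only the zero series.\<close>

definition is_y_poly :: "nat \<Rightarrow> cps2 \<Rightarrow> bool" where
  "is_y_poly d F \<longleftrightarrow> (\<forall>i j. d \<le> j \<longrightarrow> fps_of_cps2 F $ i $ j = 0)"

lemma convergent2_fps_of_cps2: "convergent2 (fps_of_cps2 F)"
  using fps_of_cps2[of F] by simp

lemma cps2_eqI: "(\<And>i j. fps_of_cps2 F $ i $ j = fps_of_cps2 G $ i $ j) \<Longrightarrow> F = G"
  by (metis fps_ext fps_of_cps2_inject)

lemma fps_of_cps2_power: "fps_of_cps2 (F ^ n) = fps_of_cps2 F ^ n"
  by (induction n) (simp_all add: one_cps2.rep_eq times_cps2.rep_eq)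

lemma fps_of_cps2_sum: "fps_of_cps2 (\<Sum>i\<in>A. f i) = (\<Sum>i\<in>A. fps_of_cps2 (f i))"
  by (induction A rule: infinite_finite_induct) (simp_all add: zero_cps2.rep_eq plus_cps2.rep_eq)

lemma fps_const_power_fps: "fps_const (c :: complex fps) ^ n = fps_const (c ^ n)"
  by (induction n) simp_all

lemma fps_of_cps2_Y_power: "fps_of_cps2 (cps2_Y ^ n) = fps_const (fps_X ^ n)"
  by (simp add: fps_of_cps2_power cps2_Y.rep_eq fps_const_power_fps)

lemma convergent2_index_shift:
  assumes "convergent2 F"
  shows "convergent2 (Abs_fps (\<lambda>i. fps_shift b (F $ (i + a))))"
proof -
  obtain K where K: "K \<ge> 1" "\<And>i j. norm (F $ i $ j) \<le> K ^ (i + j + 1)"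
    using convergent2_imp_bound[OF assms] by blast
  have "norm (F $ (i + a) $ (j + b)) \<le> K ^ (a + b + 1) * K ^ i * K ^ j" for i j
    using K(2)[of "i + a" "j + b"] by (simp add: power_add mult_ac)
  then show ?thesis
    using K(1) by (intro convergent2I[of _ "K ^ (a + b + 1)" K K]) auto
qed

lemma convergent2_fps_shift: "convergent2 F \<Longrightarrow> convergent2 (fps_shift a F)"
  using convergent2_index_shift[of F 0 a] by (simp only: fps_shift_0) (simp only: fps_shift_def)

lemma cps2_eq_X_mult:
  assumes "fps_of_cps2 F $ 0 = 0"
  obtains G where "F = cps2_X * G" "\<And>i. fps_of_cps2 G $ i = fps_of_cps2 F $ Suc i"
proof -
  define G where "G = Abs_cps2 (fps_shift 1 (fps_of_cps2 F))"
  have G: "fps_of_cps2 G = fps_shift 1 (fps_of_cps2 F)"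
    unfolding G_def by (rule Abs_cps2_inverse) (simp add: convergent2_fps_shift convergent2_fps_of_cps2)
  have "F = cps2_X * G"
    using assms by (intro cps2_eqI) (auto simp: times_cps2.rep_eq cps2_X.rep_eq G)
  then show thesis by (rule that) (simp add: G)
qed

text \<open>Splitting off the exact power of x leaves a y-regular cofactor, one not identically zero
  on the line x = 0; Weierstrass preparation applies to it.\<close>

lemma cps2_eq_X_power_mult:
  assumes "F \<noteq> 0"
  obtains a G where "F = cps2_X ^ a * G" "fps_of_cps2 G $ 0 \<noteq> 0"
    "\<And>i. fps_of_cps2 G $ i = fps_of_cps2 F $ (i + a)"
proof -
  define a where "a = subdegree (fps_of_cps2 F)"
  define G where "G = Abs_cps2 (fps_shift a (fps_of_cps2 F))"
  have G: "fps_of_cps2 G = fps_shift a (fps_of_cps2 F)"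
    unfolding G_def by (rule Abs_cps2_inverse) (simp add: convergent2_fps_shift convergent2_fps_of_cps2)
  have nz: "fps_of_cps2 F \<noteq> 0" using assms by (metis fps_of_cps2_inject zero_cps2.rep_eq)
  have "F = cps2_X ^ a * G"
    by (rule fps_of_cps2_inject[THEN iffD1])
      (simp add: times_cps2.rep_eq fps_of_cps2_power cps2_X.rep_eq G a_def,
        metis mult.commute subdegree_decompose)
  then show thesis by (rule that) (use nz in \<open>simp_all add: G a_def\<close>)
qed

lemma weierstrass_division:
  obtains Q R where "F = Q * (cps2_Y ^ d - cps2_X * H) + R" "is_y_poly d R"
    "fps_of_cps2 Q $ 0 = fps_shift d (fps_of_cps2 F $ 0)"
    "fps_of_cps2 R $ 0 = fps_cutoff d (fps_of_cps2 F $ 0)"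
proof -
  define p where "p = cps2_Y ^ d - cps2_X * H"
  have p: "fps_of_cps2 p = fps_const (fps_X ^ d) - fps_X * fps_of_cps2 H"
    by (simp add: p_def minus_cps2.rep_eq fps_of_cps2_Y_power times_cps2.rep_eq cps2_X.rep_eq)
  obtain Q' R' where QR: "convergent2 Q'" "fps_of_cps2 F = Q' * fps_of_cps2 p + R'"
    "\<And>i j. d \<le> j \<Longrightarrow> R' $ i $ j = 0" "Q' $ 0 = fps_shift d (fps_of_cps2 F $ 0)"
    "R' $ 0 = fps_cutoff d (fps_of_cps2 F $ 0)"
    using weierstrass_division_fps[OF convergent2_fps_of_cps2 convergent2_fps_of_cps2] unfolding p
    by metis
  define Q where "Q = Abs_cps2 Q'"
  have Q: "fps_of_cps2 Q = Q'" unfolding Q_def using QR(1) by (simp add: Abs_cps2_inverse)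
  define R where "R = F - Q * p"
  have R: "fps_of_cps2 R = R'"
    by (simp add: R_def minus_cps2.rep_eq times_cps2.rep_eq QR(2) Q)
  show thesis
  proof (rule that[of Q R])
    show "F = Q * (cps2_Y ^ d - cps2_X * H) + R" by (simp add: R_def p_def)
  qed (simp_all add: is_y_poly_def Q R QR(3-5))
qed

text \<open>On the line x = 0 one has p(0,y) = y^d e(y) with e(0) nonzero. Dividing by e, a unit in
  y alone, makes \<open>p\<close> congruent to y^d modulo x.\<close>

lemma ex_unit_mult_eq_Y_power:
  assumes "fps_of_cps2 p $ 0 \<noteq> 0"
  obtains u H where "u dvd 1" "u * p = cps2_Y ^ subdegree (fps_of_cps2 p $ 0) - cps2_X * H"
proof -
  define d where "d = subdegree (fps_of_cps2 p $ 0)"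
  \<comment> \<open>\<open>G $ 0\<close> is the factor e(y); convergence of it and of its inverse is
    read off from \<open>G\<close>.\<close>
  define G where "G = Abs_fps (\<lambda>i. fps_shift d (fps_of_cps2 p $ (i + 0)))"
  have G: "convergent2 G"
    unfolding G_def by (rule convergent2_index_shift[OF convergent2_fps_of_cps2])
  have G0: "G $ 0 $ 0 \<noteq> 0" using assms by (simp add: G_def d_def)
  obtain K where K: "K \<ge> 1" "\<And>i j. norm (G $ i $ j) \<le> K ^ (i + j + 1)"
    using convergent2_imp_bound[OF G] by blast
  have convG0: "convergent2 (fps_const (G $ 0))"
    by (rule convergent2I[of _ K 1 K]) (use K K(2)[of 0] in auto)
  define u e where "u = Abs_cps2 (fps_const (inverse (G $ 0)))" and "e = Abs_cps2 (fps_const (G $ 0))"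
  have u: "fps_of_cps2 u = fps_const (inverse (G $ 0))"
    unfolding u_def using convergent2_fps_const_inverse[OF G G0] by (simp add: Abs_cps2_inverse)
  have e: "fps_of_cps2 e = fps_const (G $ 0)"
    unfolding e_def using convG0 by (simp add: Abs_cps2_inverse)
  have "u * e = 1"
    by (rule fps_of_cps2_inject[THEN iffD1])
      (simp add: times_cps2.rep_eq u e one_cps2.rep_eq inverse_mult_eq_1 G0)
  then have "u dvd 1" by (metis dvd_triv_left)
  moreover have p0: "fps_of_cps2 p $ 0 = G $ 0 * fps_X ^ d"
    unfolding G_def d_def by (simp flip: subdegree_decompose)
  have "fps_of_cps2 (cps2_Y ^ d - u * p) $ 0 = 0"
    by (simp add: minus_cps2.rep_eq times_cps2.rep_eq fps_of_cps2_Y_power u p0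
        inverse_mult_eq_1 G0 flip: mult.assoc)
  then obtain H where "cps2_Y ^ d - u * p = cps2_X * H"
    using cps2_eq_X_mult by metis
  then have "u * p = cps2_Y ^ d - cps2_X * H" by (simp add: algebra_simps)
  ultimately show thesis using that by (simp add: d_def)
qed

text \<open>Here d = 0, so up to a unit \<open>F\<close> has the form 1 - x H. Weierstrass division
  of 1 by it leaves a remainder of degree below 0, that is none, and the quotient provides the
  inverse.\<close>

lemma is_unit_cps2I:
  assumes "fps_of_cps2 F $ 0 $ 0 \<noteq> 0"
  shows "F dvd 1"
proof -
  have sd: "subdegree (fps_of_cps2 F $ 0) = 0" using assms by simp
  obtain u H where u: "u * F = 1 - cps2_X * H"
    using ex_unit_mult_eq_Y_power[of F] assms sd by (metis fps_zero_nth power_0)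
  obtain Q R where "1 = Q * (cps2_Y ^ 0 - cps2_X * H) + R" "is_y_poly 0 R"
    using weierstrass_division[of 1 0 H] by metis
  moreover from this have "R = 0"
    by (intro cps2_eqI) (simp add: is_y_poly_def zero_cps2.rep_eq)
  ultimately have "Q * (u * F) = 1" unfolding power_0 u[symmetric] by simp
  then have "1 = F * (Q * u)" by (simp only: mult_ac)
  then show ?thesis by (metis dvd_triv_left)
qed

text \<open>Divide y^d by the associate y^d - x H of \<open>p\<close>. Modulo x the quotient is 1
  and the remainder is 0, so the quotient is a unit and the remainder is x times a polynomial in
  y.\<close>

lemma weierstrass_preparation:
  assumes "fps_of_cps2 p $ 0 \<noteq> 0"
  obtains d u r where "u dvd 1" "u * p = cps2_Y ^ d - cps2_X * r" "is_y_poly d r"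
proof -
  define d where "d = subdegree (fps_of_cps2 p $ 0)"
  obtain v H where v: "v dvd 1" "v * p = cps2_Y ^ d - cps2_X * H"
    using ex_unit_mult_eq_Y_power[OF assms] unfolding d_def by metis
  obtain Q R where QR: "cps2_Y ^ d = Q * (v * p) + R" "is_y_poly d R"
    "fps_of_cps2 Q $ 0 = fps_shift d (fps_X ^ d)"
    "fps_of_cps2 R $ 0 = fps_cutoff d (fps_X ^ d)"
    using weierstrass_division[of "cps2_Y ^ d" d H] unfolding v(2)
    by (metis fps_of_cps2_Y_power fps_nth_fps_const)
  have "Q dvd 1" by (rule is_unit_cps2I) (simp add: QR)
  have "fps_of_cps2 R $ 0 = 0" unfolding QR(4) by (rule fps_ext) simp
  then obtain r where r: "R = cps2_X * r" "\<And>i. fps_of_cps2 r $ i = fps_of_cps2 R $ Suc i"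
    by (rule cps2_eq_X_mult) blast
  show thesis
  proof (rule that[of "Q * v" d r])
    show "Q * v dvd 1" using mult_dvd_mono[OF \<open>Q dvd 1\<close> v(1)] by simp
    show "Q * v * p = cps2_Y ^ d - cps2_X * r" using QR(1) unfolding r(1) by (simp only: mult.assoc) (simp only: add_diff_cancel_right')
    show "is_y_poly d r" using QR(2) by (simp add: is_y_poly_def r(2))
  qed
qed

text \<open>The coefficient stays an element of \<open>cps2\<close>, so that the series in x alone
  appear as the subring on which \<open>dy\<close> vanishes.\<close>

lift_definition y_coeff :: "nat \<Rightarrow> cps2 \<Rightarrow> cps2" is "\<lambda>j F. Abs_fps (\<lambda>i. fps_const (F $ i $ j))"
proof -
  fix j and F :: "complex fps fps" assume "convergent2 F"
  then obtain K where K: "K \<ge> 1" "\<And>i j. norm (F $ i $ j) \<le> K ^ (i + j + 1)"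
    using convergent2_imp_bound by blast
  have "norm (F $ i $ j) \<le> K ^ (j + 1) * K ^ i" for i
    using K(2)[of i j] by (simp add: power_add mult_ac)
  then show "convergent2 (Abs_fps (\<lambda>i. fps_const (F $ i $ j)))"
    using K(1) by (intro convergent2I[of _ "K ^ (j + 1)" K 1]) auto
qed

lemma is_y_poly_eq_sum:
  assumes "is_y_poly d F"
  shows "F = (\<Sum>j<d. y_coeff j F * cps2_Y ^ j)"
proof (rule cps2_eqI)
  fix i l
  have "fps_of_cps2 (\<Sum>j<d. y_coeff j F * cps2_Y ^ j) $ i $ l
      = (\<Sum>j<d. if j = l then fps_of_cps2 F $ i $ l else 0)"
    unfolding fps_of_cps2_sum fps_sum_nth
    by (intro sum.cong) (auto simp: times_cps2.rep_eq fps_of_cps2_Y_power y_coeff.rep_eq)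
  then show "fps_of_cps2 F $ i $ l = fps_of_cps2 (\<Sum>j<d. y_coeff j F * cps2_Y ^ j) $ i $ l"
    using assms by (auto simp: is_y_poly_def)
qed

section \<open>Derivatives, and series in x alone\<close>

lemma dy_mult: "dy (F * G) = F * dy G + dy F * G"
proof (transfer, rule fps_ext)
  fix F G :: "complex fps fps" and i
  show "Abs_fps (\<lambda>i. fps_deriv ((F * G) $ i)) $ i
      = (F * Abs_fps (\<lambda>i. fps_deriv (G $ i)) + Abs_fps (\<lambda>i. fps_deriv (F $ i)) * G) $ i"
    by (simp add: fps_mult_nth fps_deriv_sum sum.distrib)
qed

lemma dx_mult: "dx (F * G) = F * dx G + dx F * G"
  by transfer simp

lemma dy_diff: "dy (F - G) = dy F - dy G"
  by transfer (rule fps_ext, simp)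

lemma dy_add: "dy (F + G) = dy F + dy G"
  by transfer (rule fps_ext, simp)

lemma dx_add: "dx (F + G) = dx F + dx G"
  by transfer simp

lemma dy_y_coeff: "dy (y_coeff j F) = 0"
  by transfer (rule fps_ext, simp)

lemma dx_const: "dx (const_cps2 c) = 0"
  by transfer simp

lemma dy_const: "dy (const_cps2 c) = 0"
  by transfer (rule fps_ext, simp)

lemma dy_eq_0_imp_nth: "dy F = 0 \<Longrightarrow> fps_of_cps2 F $ i = fps_const (fps_of_cps2 F $ i $ 0)"
  by transfer (metis Abs_fps_inverse UNIV_I fps_deriv_eq_0_iff fps_nth_Abs_fps fps_zero_nth)

text \<open>After the power of x is removed, the coefficients in x are shifted but still constant in
  y, so a nonzero value on x = 0 is a nonzero constant term.\<close>

lemma dy_eq_0_imp_X_power: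
  assumes "dy F = 0" "F \<noteq> 0"
  obtains n u where "F = cps2_X ^ n * u" "u dvd 1"
proof -
  obtain a G where G: "F = cps2_X ^ a * G" "fps_of_cps2 G $ 0 \<noteq> 0"
    "\<And>i. fps_of_cps2 G $ i = fps_of_cps2 F $ (i + a)"
    by (rule cps2_eq_X_power_mult[OF assms(2)]) blast
  then have "fps_of_cps2 G $ 0 $ 0 \<noteq> 0"
    using dy_eq_0_imp_nth[OF assms(1), of a] by (metis add_0 fps_const_0_eq_0)
  then show thesis using that G is_unit_cps2I by blast
qed

section \<open>Evaluation near the origin\<close>

text \<open>The explicit radius allows finitely many series to be evaluated on one common
  bidisc.\<close>

definition converges_on :: "real \<Rightarrow> cps2 \<Rightarrow> bool" where
  "converges_on r F \<longleftrightarrow> r > 0 \<and> (\<forall>x y. norm x < r \<and> norm y < r \<longrightarrow>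
     (\<lambda>(i, j). fps_of_cps2 F $ i $ j * x ^ i * y ^ j) summable_on UNIV)"

lemma ex_converges_on_common:
  assumes "finite A"
  obtains r where "r > 0" "\<And>F s. F \<in> A \<Longrightarrow> 0 < s \<Longrightarrow> s \<le> r \<Longrightarrow> converges_on s F"
  using assms
proof (induction A arbitrary: thesis rule: finite_induct)
  case empty
  then show ?case by (metis empty_iff zero_less_one)
next
  case (insert G A)
  obtain r where r: "r > 0" "\<And>F s. F \<in> A \<Longrightarrow> 0 < s \<Longrightarrow> s \<le> r \<Longrightarrow> converges_on s F"
    using insert.IH by blast
  obtain t where t: "t > 0" "\<And>x y. norm x < t \<Longrightarrow> norm y < t \<Longrightarrow>
      (\<lambda>(i, j). fps_of_cps2 G $ i $ j * x ^ i * y ^ j) summable_on UNIV"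
    using convergent2_fps_of_cps2[of G] unfolding convergent2_def by blast
  then have "converges_on s G" if "0 < s" "s \<le> t" for s
    using that by (auto simp: converges_on_def)
  with r t(1) show ?case
    by (intro insert.prems[of "min r t"]) auto
qed

text \<open>The same coefficients as in \<open>y_coeff\<close>, but as a one-variable series, so
  that \<open>eval_fps\<close> and its radius of convergence apply.\<close>

definition y_coeff_fps :: "nat \<Rightarrow> cps2 \<Rightarrow> complex fps" where
  "y_coeff_fps j F = Abs_fps (\<lambda>i. fps_of_cps2 F $ i $ j)"

definition x_section :: "cps2 \<Rightarrow> complex \<Rightarrow> complex fps" where
  "x_section F x = Abs_fps (\<lambda>j. eval_fps (y_coeff_fps j F) x)"

lemma eval_fps_eq_infsum:
  assumes "(\<lambda>n. f $ n * z ^ n) summable_on UNIV"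
  shows "eval_fps f z = (\<Sum>\<^sub>\<infinity>n. f $ n * z ^ n)" and "summable (\<lambda>n. f $ n * (z :: complex) ^ n)"
  using has_sum_imp_sums[OF has_sum_infsum[OF assms]]
  by (auto simp: eval_fps_def sums_iff)

lemma y_coeff_fps_summable_on:
  assumes "(\<lambda>(i, j). fps_of_cps2 F $ i $ j * x ^ i * y ^ j) summable_on UNIV" "y \<noteq> 0"
  shows "(\<lambda>i. y_coeff_fps j F $ i * x ^ i) summable_on UNIV"
proof -
  have "(\<lambda>(i, j). fps_of_cps2 F $ i $ j * x ^ i * y ^ j) summable_on range (\<lambda>i. (i, j))"
    by (rule summable_on_subset_banach[OF assms(1)]) simp
  then have "(\<lambda>i. fps_of_cps2 F $ i $ j * x ^ i * y ^ j) summable_on UNIV"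
    by (subst (asm) summable_on_reindex) (auto simp: inj_on_def o_def)
  then show ?thesis
    using assms(2) by (simp add: y_coeff_fps_def summable_on_cmult_left')
qed

lemma y_coeff_fps_summable_on':
  assumes "converges_on r F" "norm x < r"
  shows "(\<lambda>i. y_coeff_fps j F $ i * x ^ i) summable_on UNIV"
proof (rule y_coeff_fps_summable_on)
  \<comment> \<open>Half the radius serves as a nonzero value of y, so that y^j can be
    cancelled.\<close>
  show "(\<lambda>(i, j). fps_of_cps2 F $ i $ j * x ^ i * complex_of_real (r / 2) ^ j) summable_on UNIV"
    using assms by (auto simp: converges_on_def)
  show "complex_of_real (r / 2) \<noteq> 0" using assms by (auto simp: converges_on_def)
qed

lemma fps_conv_radius_geI:
  fixes f :: "complex fps"
  assumes "\<And>x. norm x < r \<Longrightarrow> summable (\<lambda>n. f $ n * x ^ n)"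
  shows "fps_conv_radius f \<ge> ereal r"
  unfolding fps_conv_radius_def
proof (rule conv_radius_geI_ex)
  fix t :: real assume "0 < t" "ereal t < ereal r"
  then show "\<exists>z. norm z = t \<and> summable (\<lambda>n. f $ n * z ^ n)"
    using assms by (intro exI[of _ "complex_of_real t"]) auto
qed

lemma fps_conv_radius_y_coeff_fps:
  assumes "converges_on r F"
  shows "fps_conv_radius (y_coeff_fps j F) \<ge> ereal r"
  by (intro fps_conv_radius_geI eval_fps_eq_infsum(2) y_coeff_fps_summable_on'[OF assms])

text \<open>The double series converges absolutely, so it may be summed over the powers of x first;
  this leaves the one-variable series of the section.\<close>

lemma
  assumes "converges_on r F" "norm x < r" "norm y < r"
  shows x_section_summable: "summable (\<lambda>j. x_section F x $ j * y ^ j)"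
    and eval_cps2_eq_x_section: "eval_cps2 F (x, y) = eval_fps (x_section F x) y"
proof -
  define g where "g = (\<lambda>(i, j). fps_of_cps2 F $ i $ j * x ^ i * y ^ j)"
  define h where "h = (\<lambda>(j, i). fps_of_cps2 F $ i $ j * x ^ i * y ^ j)"
  have bij: "bij_betw prod.swap UNIV (UNIV :: (nat \<times> nat) set)" by (rule bij_swap)
  have hg: "h = (\<lambda>p. g (prod.swap p))" by (auto simp: h_def g_def fun_eq_iff)
  have "g summable_on UNIV" using assms unfolding converges_on_def g_def by blast
  then have h: "h summable_on (SIGMA j:UNIV. UNIV)"
    unfolding hg by (simp add: summable_on_reindex_bij_betw[OF bij])
  have inner: "(\<Sum>\<^sub>\<infinity>i. h (j, i)) = x_section F x $ j * y ^ j" for j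
    using eval_fps_eq_infsum(1)[OF y_coeff_fps_summable_on'[OF assms(1,2), of j]]
    by (simp add: h_def x_section_def infsum_cmult_left' y_coeff_fps_def)
  have "infsum g UNIV = infsum h (SIGMA j:UNIV. UNIV)"
    unfolding hg by (simp add: infsum_reindex_bij_betw[OF bij])
  also have "\<dots> = (\<Sum>\<^sub>\<infinity>j. \<Sum>\<^sub>\<infinity>i. h (j, i))"
    using infsum_Sigma_banach[OF h] by simp
  finally have eq: "infsum g UNIV = (\<Sum>\<^sub>\<infinity>j. x_section F x $ j * y ^ j)" by (simp only: inner)
  have s: "(\<lambda>j. x_section F x $ j * y ^ j) summable_on UNIV"
    using summable_on_Sigma_banach[of "\<lambda>j i. h (j, i)" UNIV "\<lambda>_. UNIV"] h
    by (simp add: inner case_prod_eta)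
  show "summable (\<lambda>j. x_section F x $ j * y ^ j)" by (rule eval_fps_eq_infsum(2)[OF s])
  show "eval_cps2 F (x, y) = eval_fps (x_section F x) y"
    unfolding eval_fps_eq_infsum(1)[OF s] eq[symmetric] by (simp add: eval_cps2_def g_def)
qed

lemma fps_conv_radius_x_section:
  assumes "converges_on r F" "norm x < r"
  shows "fps_conv_radius (x_section F x) \<ge> ereal r"
  by (intro fps_conv_radius_geI x_section_summable[OF assms])

lemma eval_fps_sum:
  fixes f :: "'b \<Rightarrow> complex fps"
  assumes "finite A" "\<And>a. a \<in> A \<Longrightarrow> ereal (norm z) < fps_conv_radius (f a)"
  shows "eval_fps (\<Sum>a\<in>A. f a) z = (\<Sum>a\<in>A. eval_fps (f a) z)
    \<and> ereal (norm z) < fps_conv_radius (\<Sum>a\<in>A. f a)"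
  using assms
proof (induction A rule: finite_induct)
  case (insert a A)
  have "ereal (norm z) < min (fps_conv_radius (f a)) (fps_conv_radius (\<Sum>a\<in>A. f a))"
    using insert by simp
  also have "\<dots> \<le> fps_conv_radius (f a + (\<Sum>a\<in>A. f a))" by (rule fps_conv_radius_add)
  finally show ?case using insert by (simp add: eval_fps_add)
qed simp

lemma y_coeff_fps_mult:
  "y_coeff_fps j (F * G) = (\<Sum>l=0..j. y_coeff_fps l F * y_coeff_fps (j - l) G)"
proof (rule fps_ext)
  fix i
  have "y_coeff_fps j (F * G) $ i
      = (\<Sum>k=0..i. \<Sum>l=0..j. fps_of_cps2 F $ k $ l * fps_of_cps2 G $ (i - k) $ (j - l))"
    by (simp add: y_coeff_fps_def times_cps2.rep_eq fps_mult_nth fps_sum_nth)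
  also have "\<dots> = (\<Sum>l=0..j. \<Sum>k=0..i. fps_of_cps2 F $ k $ l * fps_of_cps2 G $ (i - k) $ (j - l))"
    by (rule sum.swap)
  finally show "y_coeff_fps j (F * G) $ i
      = (\<Sum>l=0..j. y_coeff_fps l F * y_coeff_fps (j - l) G) $ i"
    by (simp add: y_coeff_fps_def fps_mult_nth fps_sum_nth)
qed

lemma x_section_mult:
  assumes "converges_on r F" "converges_on r G" "norm x < r"
  shows "x_section (F * G) x = x_section F x * x_section G x"
proof (rule fps_ext)
  fix j
  have rad: "ereal (norm x) < fps_conv_radius (y_coeff_fps l F)"
    "ereal (norm x) < fps_conv_radius (y_coeff_fps l G)" for l
    using fps_conv_radius_y_coeff_fps[OF assms(1), of l] fps_conv_radius_y_coeff_fps[OF assms(2), of l]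
      assms(3) by (auto intro: less_le_trans[of _ "ereal r"])
  have rad': "ereal (norm x) < fps_conv_radius (y_coeff_fps l F * y_coeff_fps m G)" for l m
    using fps_conv_radius_mult[of "y_coeff_fps l F" "y_coeff_fps m G"] rad(1)[of l] rad(2)[of m]
    by (meson less_le_trans min_less_iff_conj)
  have "x_section (F * G) x $ j
      = (\<Sum>l=0..j. eval_fps (y_coeff_fps l F) x * eval_fps (y_coeff_fps (j - l) G) x)"
    using rad rad' by (simp add: x_section_def y_coeff_fps_mult eval_fps_sum eval_fps_mult)
  then show "x_section (F * G) x $ j = (x_section F x * x_section G x) $ j"
    by (simp add: fps_mult_nth x_section_def)
qed

lemma eval_cps2_mult:
  assumes "converges_on r F" "converges_on r G" "converges_on r (F * G)" "norm x < r" "norm y < r"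
  shows "eval_cps2 (F * G) (x, y) = eval_cps2 F (x, y) * eval_cps2 G (x, y)"
proof -
  have "ereal (norm y) < fps_conv_radius (x_section F x)" "ereal (norm y) < fps_conv_radius (x_section G x)"
    using assms fps_conv_radius_x_section by (meson less_ereal.simps(1) less_le_trans)+
  then show ?thesis
    using assms by (simp add: eval_cps2_eq_x_section[of r] x_section_mult[of r] eval_fps_mult)
qed

lemma continuous_on_eval_cps2:
  assumes "converges_on r F" "norm x < r"
  shows "continuous_on (ball 0 r) (\<lambda>y. eval_cps2 F (x, y))"
proof -
  have "continuous_on (ball 0 r) (eval_fps (x_section F x))"
    using continuous_on_eval_fps ball_eball_mono[OF fps_conv_radius_x_section[OF assms]]
    by (rule continuous_on_subset)
  then show ?thesis
    using assms by (subst continuous_on_cong[OF refl]) (auto simp: eval_cps2_eq_x_section)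
qed

lemma eval_cps2_0: "eval_cps2 0 z = 0"
  by (simp add: eval_cps2_def zero_cps2.rep_eq case_prod_unfold)

text \<open>At a root of \<open>f\<close> the factor \<open>g\<close> is nonzero, so
  \<open>\<rho>\<close> vanishes there too; cancelling the linear factor on both sides lowers both
  degrees. All roots of \<open>f\<close>, with multiplicity, thus become roots of
  \<open>\<rho>\<close>, too many for its degree.\<close>

lemma poly_eq_0_if_divisible_at_roots:
  fixes f \<rho> :: "complex poly" and g q :: "complex \<Rightarrow> complex"
  assumes "open D" "continuous_on D g" "continuous_on D q"
    and "\<And>y. poly f y = 0 \<Longrightarrow> y \<in> D \<and> g y \<noteq> 0"
    and "\<And>y. y \<in> D \<Longrightarrow> g y * poly \<rho> y = q y * poly f y"
    and "\<rho> = 0 \<or> degree \<rho> < degree f"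
  shows "\<rho> = 0"
  using assms(4-)
proof (induction "degree f" arbitrary: f \<rho>)
  case (Suc n)
  then have "\<not> constant (poly f)" by (simp add: constant_degree)
  then obtain z where z: "poly f z = 0" using fundamental_theorem_of_algebra by blast
  then have zD: "z \<in> D" "g z \<noteq> 0" using Suc.prems by auto
  have "poly \<rho> z = 0" using Suc.prems(2)[OF zD(1)] zD z by simp
  then obtain \<sigma> where \<sigma>: "\<rho> = [:- z, 1:] * \<sigma>" by (auto simp: poly_eq_0_iff_dvd)
  obtain e where e: "f = [:- z, 1:] * e" using z by (auto simp: poly_eq_0_iff_dvd)
  have "e \<noteq> 0" using Suc.hyps e by auto
  then have deg: "degree f = Suc (degree e)" unfolding e by (subst degree_mult_eq) auto
  have ne: "g y * poly \<sigma> y = q y * poly e y" if "y \<in> D" "y \<noteq> z" for y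
  proof -
    have "(y - z) * (g y * poly \<sigma> y) = (y - z) * (q y * poly e y)"
      using Suc.prems(2)[OF that(1)] by (simp add: \<sigma> e algebra_simps)
    then show ?thesis using that(2) by simp
  qed
  have "\<sigma> = 0"
  proof (rule Suc.hyps(1)[of e])
    show "n = degree e" using Suc.hyps deg by simp
    show "y \<in> D \<and> g y \<noteq> 0" if "poly e y = 0" for y using that Suc.prems(1) by (simp add: e)
    show "\<sigma> = 0 \<or> degree \<sigma> < degree e"
      using Suc.prems(3) deg degree_mult_eq[of "[:- z, 1:]" \<sigma>] by (cases "\<sigma> = 0") (auto simp: \<sigma> simp del: mult_pCons_left)
    fix y assume y: "y \<in> D"
    show "g y * poly \<sigma> y = q y * poly e y"
    proof (cases "y = z")
      case True
      \<comment> \<open>The factor y - z cannot be cancelled at y = z itself; there the identity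
        follows by continuity.\<close>
      define h where "h w = g w * poly \<sigma> w - q w * poly e w" for w
      have "continuous_on D h" unfolding h_def by (intro continuous_intros assms)
      then have "h \<midarrow>z\<rightarrow> h z"
        using zD(1) assms(1) by (simp add: continuous_on_eq_continuous_at isCont_def)
      moreover have "\<forall>\<^sub>F w in at z. h w = 0"
        unfolding eventually_at_topological h_def using ne assms(1) zD(1) by auto
      then have "h \<midarrow>z\<rightarrow> 0" by (rule tendsto_eventually)
      ultimately have "h z = 0" by (rule LIM_unique)
      then show ?thesis using True by (simp add: h_def)
    qed (use ne y in auto)
  qed
  then show ?case by (simp add: \<sigma>)
qed auto

text \<open>If |y| \<ge> s, the lower terms sum to strictly less than |y|^d. The denominator d + 1
  rather than d makes the inequality strict and covers d = 0.\<close>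

lemma monic_root_norm_less:
  fixes a :: "nat \<Rightarrow> complex"
  assumes y: "y ^ d = (\<Sum>j<d. a j * y ^ j)" and s: "0 < s" "s \<le> 1"
    and a: "\<And>j. j < d \<Longrightarrow> norm (a j) \<le> s ^ d / (real d + 1)"
  shows "norm y < s"
proof (rule ccontr)
  assume "\<not> norm y < s"
  then have ys: "s \<le> norm y" by simp
  \<comment> \<open>\<open>M\<close> dominates every lower power of |y|, whether |y| is below or
    above 1, and still s^d M \<le> |y|^d.\<close>
  define M where "M = max 1 (norm y ^ d)"
  have M: "norm y ^ j \<le> M" if "j < d" for j
  proof (cases "norm y \<le> 1")
    case True
    then have "norm y ^ j \<le> 1" by (intro power_le_one) auto
    then show ?thesis by (simp add: M_def)
  next
    case False
    then have "norm y ^ j \<le> norm y ^ d" using that by (intro power_increasing) auto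
    then show ?thesis by (simp add: M_def)
  qed
  have "norm y ^ d \<le> (\<Sum>j<d. s ^ d / (real d + 1) * M)"
    unfolding norm_power[symmetric] y
  proof (rule sum_norm_le)
    show "norm (a j * y ^ j) \<le> s ^ d / (real d + 1) * M" if "j \<in> {..<d}" for j
      unfolding norm_mult norm_power using that s by (intro mult_mono[OF a M]) auto
  qed
  also have "\<dots> = real d * (s ^ d / (real d + 1)) * M" by simp
  also have "\<dots> < s ^ d * M"
  proof (rule mult_strict_right_mono)
    show "real d * (s ^ d / (real d + 1)) < s ^ d" using s by (simp add: field_simps)
  qed (simp add: M_def)
  also have "\<dots> \<le> norm y ^ d"
  proof (cases "norm y ^ d \<le> 1")
    case True
    then show ?thesis using power_mono[OF ys, of d] s by (simp add: M_def)
  next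
    case False
    then have "M = norm y ^ d" by (simp add: M_def)
    then show ?thesis using power_le_one[of s d] s by (simp add: mult_left_le_one_le)
  qed
  finally show False by simp
qed

section \<open>Isolated common zeros and sections of polynomials in y\<close>

definition isolated_common_zero :: "cps2 \<Rightarrow> cps2 \<Rightarrow> bool" where
  "isolated_common_zero p q \<longleftrightarrow>
     (\<forall>\<^sub>F z in at (0, 0). \<not> (eval_cps2 p z = 0 \<and> eval_cps2 q z = 0))"

lemma isolated_common_zeroD:
  assumes "isolated_common_zero p q"
  obtains r where "r > 0" "\<And>x y. norm x < r \<Longrightarrow> norm y < r \<Longrightarrow> x \<noteq> 0 \<or> y \<noteq> 0 \<Longrightarrow>
    eval_cps2 p (x, y) = 0 \<Longrightarrow> eval_cps2 q (x, y) = 0 \<Longrightarrow> False"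
proof -
  obtain e where e: "e > 0" "\<And>z. z \<noteq> (0, 0) \<Longrightarrow> dist z (0, 0) < e \<Longrightarrow>
      \<not> (eval_cps2 p z = 0 \<and> eval_cps2 q z = 0)"
    using assms unfolding isolated_common_zero_def eventually_at by auto
  have "dist (x, y) (0, 0) < e" if "norm x < e / 2" "norm y < e / 2" for x y :: complex
  proof -
    have "dist (x, y) (0, 0) \<le> norm x + norm y"
      by (simp add: dist_norm sqrt_sum_squares_le_sum norm_Pair)
    then show ?thesis using that by simp
  qed
  then show thesis using e by (intro that[of "e / 2"]) auto
qed

lemma isolated_common_zeroI:
  assumes "r > 0" "\<And>x y. norm x < r \<Longrightarrow> norm y < r \<Longrightarrow> x \<noteq> 0 \<or> y \<noteq> 0 \<Longrightarrow>
    eval_cps2 p (x, y) = 0 \<Longrightarrow> eval_cps2 q (x, y) = 0 \<Longrightarrow> False"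
  shows "isolated_common_zero p q"
  unfolding isolated_common_zero_def eventually_at
proof (intro exI[of _ r] conjI ballI impI)
  fix z :: "complex \<times> complex" assume z: "z \<noteq> (0, 0) \<and> dist z (0, 0) < r"
  obtain x y where xy: "z = (x, y)" by force
  have "norm x < r" "norm y < r"
    using z dist_fst_le[of z "(0, 0)"] dist_snd_le[of z "(0, 0)"] by (auto simp: xy)
  then show "\<not> (eval_cps2 p z = 0 \<and> eval_cps2 q z = 0)"
    using assms(2)[of x y] z by (auto simp: xy)
qed (use assms in auto)

text \<open>On a common bidisc of convergence evaluation is multiplicative, so a zero of a factor is
  a zero of the product.\<close>

lemma isolated_common_zero_mult_left:
  assumes "isolated_common_zero (p * p') q"
  shows "isolated_common_zero p q" "isolated_common_zero p' q"
proof -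
  obtain r where r: "r > 0" "\<And>x y. norm x < r \<Longrightarrow> norm y < r \<Longrightarrow> x \<noteq> 0 \<or> y \<noteq> 0 \<Longrightarrow>
    eval_cps2 (p * p') (x, y) = 0 \<Longrightarrow> eval_cps2 q (x, y) = 0 \<Longrightarrow> False"
    using isolated_common_zeroD[OF assms] by blast
  obtain s where s: "s > 0" "\<And>F s'. F \<in> {p, p', p * p'} \<Longrightarrow> 0 < s' \<Longrightarrow> s' \<le> s \<Longrightarrow> converges_on s' F"
    using ex_converges_on_common[of "{p, p', p * p'}"] by blast
  define t where "t = min r s"
  have t: "t > 0" using r s by (simp add: t_def)
  have mult: "eval_cps2 (p * p') (x, y) = eval_cps2 p (x, y) * eval_cps2 p' (x, y)"
    if "norm x < t" "norm y < t" for x y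
    by (rule eval_cps2_mult[of t]) (use that s t in \<open>auto simp: t_def\<close>)
  show "isolated_common_zero p q" "isolated_common_zero p' q"
    by (rule isolated_common_zeroI[OF t], rule r(2), (use mult in \<open>auto simp: t_def\<close>))+
qed

lemma x_section_y_poly:
  assumes "is_y_poly d F"
  shows "x_section F x = fps_of_poly (\<Sum>j<d. monom (eval_fps (y_coeff_fps j F) x) j)"
proof (rule fps_ext)
  fix n
  have "y_coeff_fps n F = 0" if "\<not> n < d"
    using assms that by (intro fps_ext) (auto simp: y_coeff_fps_def is_y_poly_def)
  then show "x_section F x $ n = fps_of_poly (\<Sum>j<d. monom (eval_fps (y_coeff_fps j F) x) j) $ n"
    by (auto simp: x_section_def coeff_sum)
qed

lemma x_section_weierstrass_poly:
  assumes "is_y_poly d R" "converges_on r R" "norm x < r"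
  shows "x_section (cps2_Y ^ d - cps2_X * R) x
    = fps_of_poly (monom 1 d - (\<Sum>j<d. monom (x * eval_fps (y_coeff_fps j R) x) j))"
proof (rule fps_ext)
  fix n
  have "y_coeff_fps n (cps2_Y ^ d - cps2_X * R) = (if n = d then 1 else 0) - fps_X * y_coeff_fps n R"
    by (intro fps_ext)
      (auto simp: y_coeff_fps_def minus_cps2.rep_eq fps_of_cps2_Y_power times_cps2.rep_eq cps2_X.rep_eq)
  moreover have "ereal (norm x) < fps_conv_radius (y_coeff_fps n R)"
    using fps_conv_radius_y_coeff_fps[OF assms(2), of n] assms(3)
    by (auto intro: less_le_trans[of _ "ereal r"])
  moreover from this have "ereal (norm x) < fps_conv_radius (fps_X * y_coeff_fps n R)"
    using fps_conv_radius_mult[of fps_X "y_coeff_fps n R"] by (auto intro: less_le_trans)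
  ultimately have "x_section (cps2_Y ^ d - cps2_X * R) x $ n
      = (if n = d then 1 else 0) - x * eval_fps (y_coeff_fps n R) x"
    by (auto simp: x_section_def eval_fps_diff eval_fps_mult)
  moreover have "y_coeff_fps n R = 0" if "\<not> n < d"
    using assms(1) that by (intro fps_ext) (auto simp: y_coeff_fps_def is_y_poly_def)
  ultimately show "x_section (cps2_Y ^ d - cps2_X * R) x $ n
      = fps_of_poly (monom 1 d - (\<Sum>j<d. monom (x * eval_fps (y_coeff_fps j R) x) j)) $ n"
    by (auto simp: coeff_sum)
qed

section \<open>Ideals with an isolated zero\<close>

text \<open>Continuity supplies the value at 0, and the identity theorem for power series does the
  rest.\<close>

lemma fps_eq_0_if_eval_eventually_0:
  fixes f :: "complex fps"
  assumes "fps_conv_radius f > 0" "\<forall>\<^sub>F x in at 0. eval_fps f x = 0"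
  shows "f = 0"
proof -
  have "continuous (at 0) (eval_fps f)"
    using assms(1) by (intro continuous_eval_fps) (simp add: zero_ereal_def)
  then have "eval_fps f \<midarrow>0\<rightarrow> eval_fps f 0" by (simp add: isCont_def)
  moreover have "eval_fps f \<midarrow>0\<rightarrow> 0" using assms(2) by (rule tendsto_eventually)
  ultimately have "eval_fps f 0 = 0" by (rule LIM_unique)
  then have "\<forall>\<^sub>F x in nhds 0. eval_fps f x = eval_fps 0 x"
    using assms(2) by (simp add: eventually_nhds_conv_at)
  then show ?thesis using assms(1) by (intro eval_fps_eqD) auto
qed

text \<open>For small \<open>x \<noteq> 0\<close> the polynomial \<open>P(x, _)\<close> has all its \<open>d\<close> roots near \<open>0\<close>, and \<open>q(x, _)\<close>
  vanishes at none of them; hence the remainder of \<open>c\<close>, of degree less than \<open>d\<close> in \<open>y\<close>, must be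
  divisible by \<open>P(x, _)\<close>.\<close>

lemma weierstrass_poly_dvd_cancel:
  assumes P: "P = cps2_Y ^ d - cps2_X * R" and R: "is_y_poly d R"
    and iso: "isolated_common_zero P q" and dvd: "P dvd q * c"
  shows "P dvd c"
proof -
  obtain Q \<rho> where \<rho>: "c = Q * P + \<rho>" "is_y_poly d \<rho>"
    by (rule weierstrass_division[of c d R, folded P]) (rule that)
  \<comment> \<open>Since \<open>c\<close> and its remainder differ by a multiple of
    \<open>P\<close>, it is enough to show that the remainder is zero.\<close>
  have "q * \<rho> = q * c - P * (q * Q)"
    using \<rho>(1) by algebra
  moreover have "P dvd q * c - P * (q * Q)"
    using dvd dvd_triv_left by (rule dvd_diff)
  ultimately have "P dvd q * \<rho>" by (simp only:)
  then obtain W where W: "q * \<rho> = P * W" by blast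
  obtain r where r: "r > 0" "\<And>x y. norm x < r \<Longrightarrow> norm y < r \<Longrightarrow> x \<noteq> 0 \<or> y \<noteq> 0 \<Longrightarrow>
    eval_cps2 P (x, y) = 0 \<Longrightarrow> eval_cps2 q (x, y) = 0 \<Longrightarrow> False"
    using isolated_common_zeroD[OF iso] by blast
  define A where "A = {P, q, \<rho>, W, R, q * \<rho>}"
  obtain s where s: "s > 0" "\<And>F s'. F \<in> A \<Longrightarrow> 0 < s' \<Longrightarrow> s' \<le> s \<Longrightarrow> converges_on s' F"
    using ex_converges_on_common[of A] by (auto simp: A_def)
  \<comment> \<open>The bounds come from isolation of the zero, from convergence, and from the root
    estimate, which needs radius at most 1.\<close>
  define t where "t = min 1 (min r s)"
  have t: "t > 0" "t \<le> 1" "t \<le> r" "t \<le> s" using r s by (auto simp: t_def)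
  have conv: "converges_on t F" if "F \<in> A" for F using s that t by auto
  define a where "a j x = x * eval_fps (y_coeff_fps j R) x" for j x
  define f where "f x = monom 1 d - (\<Sum>j<d. monom (a j x) j)" for x
  define \<pi> where "\<pi> x = (\<Sum>j<d. monom (eval_fps (y_coeff_fps j \<rho>) x) j)" for x
  have eval_P: "eval_cps2 P (x, y) = poly (f x) y" if "norm x < t" "norm y < t" for x y
    using that conv[of P] conv[of R] x_section_weierstrass_poly[OF R, of t x]
    by (simp add: A_def eval_cps2_eq_x_section[of t] f_def a_def flip: P)
  have eval_\<rho>: "eval_cps2 \<rho> (x, y) = poly (\<pi> x) y" if "norm x < t" "norm y < t" for x y
    using that conv[of \<rho>] x_section_y_poly[OF \<rho>(2), of x]
    by (simp add: A_def eval_cps2_eq_x_section[of t] \<pi>_def)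
  have rad: "fps_conv_radius (y_coeff_fps j F) > 0" if "F \<in> A" for F j
  proof -
    have "0 < ereal t" using t by simp
    then show ?thesis
      using fps_conv_radius_y_coeff_fps[OF conv[OF that]] by (rule less_le_trans)
  qed
  have "\<forall>\<^sub>F x in at 0. norm (a j x) < (t / 2) ^ d / (real d + 1)" for j
  proof -
    have "continuous (at 0) (eval_fps (y_coeff_fps j R))"
      using rad[of R j] by (intro continuous_eval_fps) (simp add: A_def zero_ereal_def)
    then have "isCont (a j) 0"
      unfolding a_def by (intro continuous_mult continuous_ident)
    then have "((\<lambda>x. norm (a j x)) \<longlongrightarrow> norm (a j 0)) (at 0)"
      unfolding isCont_def by (rule tendsto_norm)
    \<comment> \<open>Below y^d every coefficient of \<open>P\<close> carries a factor x, so
      \<open>a j 0\<close> = 0. Hence for small x all roots of P(x,_) have norm below t/2.\<close>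
    moreover have "norm (a j 0) < (t / 2) ^ d / (real d + 1)" using t by (simp add: a_def)
    ultimately show ?thesis by (rule order_tendstoD(2))
  qed
  then have small: "\<forall>\<^sub>F x in at 0. \<forall>j\<in>{..<d}. norm (a j x) < (t / 2) ^ d / (real d + 1)"
    by (intro eventually_ball_finite) auto
  have \<pi>0: "\<pi> x = 0" if x: "norm x < t" "x \<noteq> 0"
    and small: "\<forall>j\<in>{..<d}. norm (a j x) < (t / 2) ^ d / (real d + 1)" for x
  proof (rule poly_eq_0_if_divisible_at_roots[where D = "ball 0 t" and f = "f x"])
    show "open (ball 0 t :: complex set)" by simp
    show "continuous_on (ball 0 t) (\<lambda>y. eval_cps2 q (x, y))"
      by (intro continuous_on_eval_cps2 conv x) (simp add: A_def)
    show "continuous_on (ball 0 t) (\<lambda>y. eval_cps2 W (x, y))"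
      by (intro continuous_on_eval_cps2 conv x) (simp add: A_def)
    fix y
    \<comment> \<open>A root y gives a zero (x, y) of \<open>P\<close> off the origin because x is
      nonzero, and isolation then keeps \<open>q\<close> nonzero there.\<close>
    show "y \<in> ball 0 t \<and> eval_cps2 q (x, y) \<noteq> 0" if y: "poly (f x) y = 0"
    proof -
      have "y ^ d = (\<Sum>j<d. a j x * y ^ j)"
        using y by (simp add: f_def poly_monom poly_sum)
      then have "norm y < t / 2"
        by (rule monic_root_norm_less) (use t small in \<open>auto intro: less_imp_le\<close>)
      then have yt: "norm y < t" using t by simp
      then have "eval_cps2 P (x, y) = 0" using y x by (simp add: eval_P)
      then show ?thesis using r(2)[of x y] x yt t by auto
    qed
    show "eval_cps2 q (x, y) * poly (\<pi> x) y = eval_cps2 W (x, y) * poly (f x) y" if "y \<in> ball 0 t"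
    proof -
      have y: "norm y < t" using that by simp
      have "eval_cps2 q (x, y) * poly (\<pi> x) y = eval_cps2 (q * \<rho>) (x, y)"
        using eval_cps2_mult[of t q \<rho> x y] conv x y by (simp add: A_def eval_\<rho>)
      also have "\<dots> = eval_cps2 (P * W) (x, y)" by (simp add: W)
      also have "\<dots> = eval_cps2 W (x, y) * poly (f x) y"
        using eval_cps2_mult[of t P W x y] conv[of "q * \<rho>"] conv x y by (simp add: A_def eval_P W)
      finally show ?thesis .
    qed
    show "\<pi> x = 0 \<or> degree (\<pi> x) < degree (f x)"
    proof (cases "\<pi> x = 0")
      case False
      have "coeff (\<pi> x) k = 0" if "k \<ge> d" for k using that by (simp add: \<pi>_def coeff_sum)
      with False have "degree (\<pi> x) < d" by (metis leading_coeff_0_iff not_le)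
      also have "coeff (f x) d = 1" by (simp add: f_def coeff_sum)
      then have "d \<le> degree (f x)" by (intro le_degree) simp
      finally show ?thesis by simp
    qed simp
  qed
  \<comment> \<open>Each coefficient of the remainder vanishes at all small nonzero x, hence
    identically.\<close>
  have "y_coeff_fps j \<rho> = 0" if j: "j < d" for j
  proof (rule fps_eq_0_if_eval_eventually_0)
    show "fps_conv_radius (y_coeff_fps j \<rho>) > 0"
      by (rule rad) (simp add: A_def)
    have "\<forall>\<^sub>F x in at 0. norm x < t"
      using t(1) by (auto simp: eventually_at dist_norm intro!: exI[of _ t])
    moreover have "\<forall>\<^sub>F x in at 0. (x :: complex) \<noteq> 0" by (simp add: eventually_at_filter)
    moreover note small
    ultimately show "\<forall>\<^sub>F x in at 0. eval_fps (y_coeff_fps j \<rho>) x = 0"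
    proof eventually_elim
      case (elim x)
      then have "coeff (\<pi> x) j = 0" using \<pi>0 by simp
      then show ?case using j by (simp add: \<pi>_def coeff_sum)
    qed
  qed
  then have "fps_of_cps2 \<rho> $ i $ j = 0" for i j
    using \<rho>(2) unfolding is_y_poly_def y_coeff_fps_def
    by (metis fps_nth_Abs_fps fps_zero_nth not_le)
  then have "\<rho> = 0" by (intro cps2_eqI) (simp add: zero_cps2.rep_eq)
  then show ?thesis by (simp add: \<rho>(1))
qed

section \<open>Powers of x and y in the ideal of an isolated zero\<close>

lemma ideal_gen_pair: "ideal_gen {p, q} = {a * p + b * q | a b. True}"
  unfolding cps2_ideal.span_insert cps2_ideal.span_singleton
  by (auto simp: image_iff algebra_simps diff_eq_eq)

lemma dvd_power_diff_power: "(a - b) dvd a ^ n - (b :: 'a :: comm_ring_1) ^ n"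
  by (cases n) (simp, simp only: diff_power_eq_sum dvd_triv_left)

lemma isolated_common_zero_regular:
  assumes reg: "fps_of_cps2 p $ 0 \<noteq> 0" and iso: "isolated_common_zero p q"
  obtains N M where "cps2_X ^ N \<in> ideal_gen {p, q}" "cps2_Y ^ M \<in> ideal_gen {p, q}"
proof -
  obtain d u R where u: "u dvd 1" and up: "u * p = cps2_Y ^ d - cps2_X * R" and R: "is_y_poly d R"
    by (rule weierstrass_preparation[OF reg])
  define P where "P = u * p"
  note P = up[folded P_def]
  obtain u' where u': "1 = u * u'" using u by blast
  have "p = u' * P" unfolding P_def mult.assoc[symmetric] mult.commute[of u' u] u'[symmetric] by simp
  \<comment> \<open>Every zero of \<open>P\<close> is a zero of its multiple
    \<open>p\<close>.\<close>
  then have isoP: "isolated_common_zero P q" using iso isolated_common_zero_mult_left(2) by metis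
  have "\<exists>Q \<rho>. q ^ i = Q * P + \<rho> \<and> is_y_poly d \<rho>" for i
    by (rule weierstrass_division[of "q ^ i" d R, folded P]) (intro exI conjI)
  then obtain Q \<rho> where \<rho>: "\<And>i. q ^ i = Q i * P + \<rho> i" "\<And>i. is_y_poly d (\<rho> i)" by metis
  \<comment> \<open>The remainders of 1, q, ..., q^d modulo \<open>P\<close> are d + 1 vectors of
    length d over the series in x, which are the elements with \<open>dy\<close> equal to 0.\<close>
  have "\<exists>a. (\<forall>i\<in>{..d}. a i \<in> {F. dy F = 0}) \<and> (\<exists>i\<in>{..d}. a i \<noteq> 0) \<and>
      (\<forall>j<d. (\<Sum>i\<in>{..d}. a i * y_coeff j (\<rho> i)) = 0)"
  proof (rule ex_linear_relation)
    show "0 \<in> {F. dy F = 0}" "1 \<in> {F. dy F = 0}"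
      by (simp_all, (transfer, rule fps_ext, simp)+)
  qed (simp_all add: dy_diff dy_mult dy_y_coeff)
  then obtain a where a: "\<And>i. i \<le> d \<Longrightarrow> dy (a i) = 0" "\<exists>i. i \<le> d \<and> a i \<noteq> 0"
    "\<And>j. j < d \<Longrightarrow> (\<Sum>i\<le>d. a i * y_coeff j (\<rho> i)) = 0"
    unfolding mem_Collect_eq atMost_iff Ball_def Bex_def by blast
  have "(\<Sum>i\<le>d. a i * \<rho> i) = (\<Sum>i\<le>d. \<Sum>j<d. a i * y_coeff j (\<rho> i) * cps2_Y ^ j)"
  proof (rule sum.cong)
    fix i
    have "a i * \<rho> i = a i * (\<Sum>j<d. y_coeff j (\<rho> i) * cps2_Y ^ j)"
      using is_y_poly_eq_sum[OF \<rho>(2)] by (rule arg_cong)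
    then show "a i * \<rho> i = (\<Sum>j<d. a i * y_coeff j (\<rho> i) * cps2_Y ^ j)"
      by (simp only: sum_distrib_left mult.assoc)
  qed simp
  also have "\<dots> = (\<Sum>j<d. \<Sum>i\<le>d. a i * y_coeff j (\<rho> i) * cps2_Y ^ j)" by (rule sum.swap)
  also have "\<dots> = 0" using a(3) by (simp flip: sum_distrib_right)
  finally have rel: "(\<Sum>i\<le>d. a i * \<rho> i) = 0" .
  have "(\<Sum>i\<le>d. a i * q ^ i) = (\<Sum>i\<le>d. P * (a i * Q i) + a i * \<rho> i)"
    by (intro sum.cong) (simp_all only: \<rho>(1) distrib_left mult_ac)
  also have "\<dots> = P * (\<Sum>i\<le>d. a i * Q i)"
    by (simp only: sum.distrib rel sum_distrib_left add_0_right)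
  finally have dvd: "P dvd (\<Sum>i\<le>d. a i * q ^ i)" by (rule dvdI)
  \<comment> \<open>Taking the lowest nonzero coefficient lets q^m be factored out, with a nonzero
    series in x left as the term free of \<open>q\<close>.\<close>
  define m where "m = (LEAST i. i \<le> d \<and> a i \<noteq> 0)"
  have m: "m \<le> d" "a m \<noteq> 0" using LeastI_ex[OF a(2)] by (auto simp: m_def)
  have less_m: "a i = 0" if "i < m" for i
    using not_less_Least[of i "\<lambda>i. i \<le> d \<and> a i \<noteq> 0"] that m(1) unfolding m_def[symmetric] by auto
  define w where "w = (\<Sum>i\<in>{m<..d}. a i * q ^ (i - Suc m))"
  have "(\<Sum>i\<le>d. a i * q ^ i) = (\<Sum>i\<in>{m..d}. a i * q ^ i)"
    using less_m by (intro sum.mono_neutral_right) auto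
  also have "\<dots> = a m * q ^ m + (\<Sum>i\<in>{m<..d}. a i * q ^ i)"
    by (rule sum.head[OF m(1)])
  also have "(\<Sum>i\<in>{m<..d}. a i * q ^ i) = (\<Sum>i\<in>{m<..d}. q ^ Suc m * (a i * q ^ (i - Suc m)))"
  proof (rule sum.cong)
    fix i assume "i \<in> {m<..d}"
    then have "q ^ i = q ^ Suc m * q ^ (i - Suc m)" by (simp flip: power_add del: power_Suc)
    then show "a i * q ^ i = q ^ Suc m * (a i * q ^ (i - Suc m))" by (simp only: mult_ac)
  qed simp
  also have "a m * q ^ m + \<dots> = q ^ m * (a m + q * w)"
    by (simp only: w_def sum_distrib_left power_Suc distrib_left mult_ac)
  finally have "P dvd q ^ m * (a m + q * w)" using dvd by (simp only:)
  moreover have "P dvd v" if "P dvd q ^ m * v" for m v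
    using that
  proof (induction m)
    case (Suc m)
    then have "P dvd q * (q ^ m * v)" by (simp only: power_Suc mult.assoc)
    then have "P dvd q ^ m * v" by (rule weierstrass_poly_dvd_cancel[OF P R isoP])
    then show ?case by (rule Suc.IH)
  qed simp
  ultimately have "P dvd a m + q * w" by blast
  then obtain z where z: "a m + q * w = P * z" by blast
  obtain N e where N: "a m = cps2_X ^ N * e" "e dvd 1"
    using dy_eq_0_imp_X_power[OF a(1)[OF m(1)] m(2)] by blast
  then obtain e' where e': "1 = e * e'" by blast
  have "cps2_X ^ N = a m * e'" unfolding N(1) mult.assoc e'[symmetric] by simp
  also have "a m = (u * z) * p - w * q" using z unfolding P_def by algebra
  also have "\<dots> * e' = (e' * (u * z)) * p + (- (e' * w)) * q" by algebra
  finally have XN: "cps2_X ^ N \<in> ideal_gen {p, q}" unfolding ideal_gen_pair by blast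
  \<comment> \<open>Modulo \<open>p\<close> one has y^d = x R, so the power of x just found yields a
    power of y.\<close>
  have "u * p dvd (cps2_Y ^ d) ^ N - (cps2_X * R) ^ N"
    unfolding up by (rule dvd_power_diff_power)
  then obtain y where y: "(cps2_Y ^ d) ^ N - (cps2_X * R) ^ N = u * p * y" by blast
  have "cps2_Y ^ (d * N) = (u * y) * p + R ^ N * cps2_X ^ N"
    using y unfolding power_mult power_mult_distrib diff_eq_eq by (simp only: mult_ac)
  also have "\<dots> \<in> ideal_gen {p, q}"
    by (intro cps2_ideal.span_add cps2_ideal.span_scale[OF XN]
        cps2_ideal.span_scale[OF cps2_ideal.span_base]) simp
  finally show thesis using that XN by blast
qed

lemma eval_cps2_0_left:
  assumes "fps_of_cps2 F $ 0 = 0"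
  shows "eval_cps2 F (0, y) = 0"
proof -
  have "(\<lambda>(i, j). fps_of_cps2 F $ i $ j * 0 ^ i * y ^ j) = (\<lambda>_. 0)"
    using assms by (auto simp: fun_eq_iff power_0_left)
  then show ?thesis by (simp add: eval_cps2_def)
qed

text \<open>Write p = x^a p' with p' y-regular. The regular case gives powers of x and y in (p', q);
  multiplying by x^a handles x, while y needs a further power of y in (x^a, q).\<close>

lemma isolated_common_zero_ideal_nonzero:
  assumes iso: "isolated_common_zero p q" and "p \<noteq> 0"
  obtains N M where "cps2_X ^ N \<in> ideal_gen {p, q}" "cps2_Y ^ M \<in> ideal_gen {p, q}"
proof -
  obtain a p' where p: "p = cps2_X ^ a * p'" and p': "fps_of_cps2 p' $ 0 \<noteq> 0"
    by (rule cps2_eq_X_power_mult[OF assms(2)]) blast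
  have iso': "isolated_common_zero (cps2_X ^ a) q" "isolated_common_zero p' q"
    using isolated_common_zero_mult_left iso unfolding p by blast+
  obtain N M where NM: "cps2_X ^ N \<in> ideal_gen {p', q}" "cps2_Y ^ M \<in> ideal_gen {p', q}"
    by (rule isolated_common_zero_regular[OF p' iso'(2)])
  obtain x1 x2 y1 y2 where X: "cps2_X ^ N = x1 * p' + x2 * q" and Y: "cps2_Y ^ M = y1 * p' + y2 * q"
    using NM unfolding ideal_gen_pair by blast
  have "\<exists>k h z. cps2_Y ^ k = z * q + cps2_X ^ a * h"
  proof (cases a)
    case 0
    then show ?thesis by (intro exI[of _ 0] exI[of _ 1]) simp
  next
    case (Suc b)
    then have isoX: "isolated_common_zero cps2_X q"
      using isolated_common_zero_mult_left(1)[of cps2_X "cps2_X ^ b" q] iso'(1) by simp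
    \<comment> \<open>Otherwise x and \<open>q\<close> would vanish together along the whole line x
      = 0.\<close>
    have "fps_of_cps2 q $ 0 \<noteq> 0"
    proof
      assume q0: "fps_of_cps2 q $ 0 = 0"
      obtain r where r: "r > 0" "\<And>x y. norm x < r \<Longrightarrow> norm y < r \<Longrightarrow> x \<noteq> 0 \<or> y \<noteq> 0 \<Longrightarrow>
          eval_cps2 cps2_X (x, y) = 0 \<Longrightarrow> eval_cps2 q (x, y) = 0 \<Longrightarrow> False"
        using isolated_common_zeroD[OF isoX] by blast
      show False
        by (rule r(2)[of 0 "complex_of_real (r / 2)"])
          (use r(1) q0 in \<open>auto simp: eval_cps2_0_left cps2_X.rep_eq\<close>)
    qed
    then obtain u H m where uq: "u * q = cps2_Y ^ m - cps2_X * H"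
      using ex_unit_mult_eq_Y_power by metis
    have "u * q dvd (cps2_Y ^ m) ^ a - (cps2_X * H) ^ a"
      unfolding uq by (rule dvd_power_diff_power)
    then obtain y where "(cps2_Y ^ m) ^ a - (cps2_X * H) ^ a = u * q * y" by blast
    then have "cps2_Y ^ (m * a) = (u * y) * q + cps2_X ^ a * H ^ a"
      unfolding power_mult power_mult_distrib diff_eq_eq by (simp only: mult_ac)
    then show ?thesis by (intro exI)
  qed
  then obtain k h z where k: "cps2_Y ^ k = z * q + cps2_X ^ a * h" by blast
  have "cps2_X ^ (a + N) = x1 * p + (cps2_X ^ a * x2) * q"
    unfolding power_add X p by (simp only: distrib_left mult_ac)
  moreover have "cps2_Y ^ (k + M) = (h * y1) * p + (z * cps2_Y ^ M + cps2_X ^ a * h * y2) * q"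
    unfolding power_add k Y p by (simp only: distrib_left distrib_right mult_ac add_ac)
  ultimately show thesis
    using that unfolding ideal_gen_pair by blast
qed

lemma isolated_common_zero_ideal:
  assumes "isolated_common_zero p q"
  obtains N M where "cps2_X ^ N \<in> ideal_gen {p, q}" "cps2_Y ^ M \<in> ideal_gen {p, q}"
proof (cases "p = 0")
  case True
  have sym: "isolated_common_zero q p"
    using assms unfolding isolated_common_zero_def by (simp add: conj_commute)
  have "q \<noteq> 0"
  proof
    assume q: "q = 0"
    obtain r where r: "r > 0" "\<And>x y. norm x < r \<Longrightarrow> norm y < r \<Longrightarrow> x \<noteq> 0 \<or> y \<noteq> 0 \<Longrightarrow>
        eval_cps2 p (x, y) = 0 \<Longrightarrow> eval_cps2 q (x, y) = 0 \<Longrightarrow> False"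
      using isolated_common_zeroD[OF assms] by blast
    show False
      by (rule r(2)[of 0 "complex_of_real (r / 2)"])
        (use r(1) q True in \<open>auto simp: eval_cps2_0\<close>)
  qed
  then show thesis
    using isolated_common_zero_ideal_nonzero[OF sym] that by (metis insert_commute)
next
  case False
  then show thesis using isolated_common_zero_ideal_nonzero[OF assms] that by blast
qed

section \<open>Finite codimension of ideals containing powers of x and y\<close>

lemma dy_eq_0_expansion:
  assumes "dy F = 0"
  shows "\<exists>c G. F = (\<Sum>i<N. const_cps2 (c i) * cps2_X ^ i) + cps2_X ^ N * G \<and> dy G = 0"
proof (induction N)
  case 0
  show ?case using assms by (intro exI[of _ "\<lambda>_. 0"] exI[of _ F]) simp
next
  case (Suc N)
  then obtain c G where G: "F = (\<Sum>i<N. const_cps2 (c i) * cps2_X ^ i) + cps2_X ^ N * G" "dy G = 0"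
    by blast
  define e where "e = fps_of_cps2 G $ 0 $ 0"
  have "fps_of_cps2 (G - const_cps2 e) $ 0 = 0"
    using dy_eq_0_imp_nth[OF G(2), of 0] by (simp add: minus_cps2.rep_eq const_cps2.rep_eq e_def)
  then obtain G' where G': "G - const_cps2 e = cps2_X * G'"
    by (rule cps2_eq_X_mult) blast
  \<comment> \<open>The new cofactor is again free of y: \<open>dy\<close> commutes with
    multiplication by x, and x is not a zero divisor. This carries the induction.\<close>
  have "dy (cps2_X * G') = 0" by (simp add: G(2) dy_diff dy_const flip: G')
  moreover have "dy cps2_X = 0"
    by transfer (rule fps_ext, simp add: fps_X_def)
  moreover have "cps2_X \<noteq> 0" by transfer simp
  ultimately have G'0: "dy G' = 0" by (simp add: dy_mult)
  have "G = const_cps2 e + cps2_X * G'" using G' by algebra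
  then have "F = (\<Sum>i<N. const_cps2 (c i) * cps2_X ^ i) + cps2_X ^ N * (const_cps2 e + cps2_X * G')"
    using G(1) by (simp only:)
  moreover have "(\<Sum>i<Suc N. const_cps2 ((c(N := e)) i) * cps2_X ^ i)
      = (\<Sum>i<N. const_cps2 (c i) * cps2_X ^ i) + const_cps2 e * cps2_X ^ N" by simp
  ultimately have "F = (\<Sum>i<Suc N. const_cps2 ((c(N := e)) i) * cps2_X ^ i) + cps2_X ^ Suc N * G'"
    by (simp only: power_Suc distrib_left mult_ac add_ac)
  with G'0 show ?case by blast
qed

text \<open>Division by y^M leaves a polynomial in y, and its coefficients may be truncated at x^N.
  So the monomials x^i y^j with i < N and j < M span modulo the ideal.\<close>

lemma finite_spanning_mod_ideal:
  assumes "cps2_X ^ N \<in> ideal_gen S" "cps2_Y ^ M \<in> ideal_gen S"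
  obtains B where "finite B" "\<And>F. \<exists>b\<in>cps2.span B. F - b \<in> ideal_gen S"
proof -
  define B where "B = (\<lambda>(i, j). cps2_X ^ i * cps2_Y ^ j) ` ({..<N} \<times> {..<M})"
  have "finite B" by (simp add: B_def)
  moreover have "\<exists>b\<in>cps2.span B. F - b \<in> ideal_gen S" for F
  proof -
    obtain Q R where QR: "F = Q * cps2_Y ^ M + R" "is_y_poly M R"
      by (rule weierstrass_division[of F M 0, unfolded mult_zero_right diff_0_right]) (rule that)
    have "\<exists>c G. y_coeff j R = (\<Sum>i<N. const_cps2 (c i) * cps2_X ^ i) + cps2_X ^ N * G" for j
      using dy_eq_0_expansion[OF dy_y_coeff] by blast
    then obtain c G where cG: "\<And>j. y_coeff j R = (\<Sum>i<N. const_cps2 (c j i) * cps2_X ^ i) + cps2_X ^ N * G j"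
      by metis
    define b where "b = (\<Sum>j<M. \<Sum>i<N. scale_cps2 (c j i) (cps2_X ^ i * cps2_Y ^ j))"
    have "R = (\<Sum>j<M. y_coeff j R * cps2_Y ^ j)" by (rule is_y_poly_eq_sum[OF QR(2)])
    also have "\<dots> = b + (\<Sum>j<M. G j * cps2_Y ^ j) * cps2_X ^ N"
      by (simp only: cG b_def scale_cps2_def sum_distrib_left sum_distrib_right
          distrib_left distrib_right sum.distrib mult_ac)
    finally have R: "R = b + (\<Sum>j<M. G j * cps2_Y ^ j) * cps2_X ^ N" .
    then have "F - b = Q * cps2_Y ^ M + (\<Sum>j<M. G j * cps2_Y ^ j) * cps2_X ^ N"
      by (simp only: QR(1) R diff_eq_eq add_ac)
    also have "\<dots> \<in> ideal_gen S"
      using assms by (intro cps2_ideal.span_add cps2_ideal.span_scale)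
    finally have "F - b \<in> ideal_gen S" .
    moreover have "b \<in> cps2.span B"
      unfolding b_def by (intro cps2.span_sum cps2.span_scale cps2.span_base) (auto simp: B_def)
    ultimately show ?thesis by blast
  qed
  ultimately show thesis using that by blast
qed

section \<open>The Tjurina number of a pair\<close>

lemma omega_isolated_singularity_iff:
  "omega_isolated_singularity f g \<longleftrightarrow> isolated_common_zero (omega_x f g) (omega_y f g)"
  by (simp add: omega_isolated_singularity_def isolated_common_zero_def)

section \<open>Cancellation modulo a series\<close>

lemma cps2_X_nonzero: "cps2_X \<noteq> 0"
  by transfer simp

text \<open>Restricted to the line x = 0, y is not a zero divisor; hence the factors x can be moved
  to \<open>u\<close> one at a time.\<close>

lemma cps2_X_power_dvd_Y_power_mult:
  "cps2_X ^ n dvd cps2_Y ^ m * u \<Longrightarrow> cps2_X ^ n dvd u"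
proof (induction n arbitrary: u)
  case (Suc n)
  then obtain v where "cps2_Y ^ m * u = cps2_X ^ Suc n * v" by (elim dvdE)
  then have v: "cps2_Y ^ m * u = cps2_X * (cps2_X ^ n * v)" by (simp only: power_Suc mult.assoc)
  have "fps_of_cps2 (cps2_X * F) $ 0 = 0" for F
    by (simp add: times_cps2.rep_eq cps2_X.rep_eq)
  then have "fps_of_cps2 (cps2_Y ^ m * u) $ 0 = 0" by (simp only: v)
  then have "fps_X ^ m * fps_of_cps2 u $ 0 = 0"
    by (simp only: times_cps2.rep_eq fps_of_cps2_Y_power fps_mult_left_const_nth)
  then have "fps_of_cps2 u $ 0 = 0" by simp
  then obtain w where w: "u = cps2_X * w" by (rule cps2_eq_X_mult) blast
  have "cps2_X * (cps2_Y ^ m * w) = cps2_X * (cps2_X ^ n * v)"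
    using v unfolding w by (simp only: mult_ac)
  then have "cps2_Y ^ m * w = cps2_X ^ n * v" using cps2_X_nonzero by simp
  then have "cps2_X ^ n dvd cps2_Y ^ m * w" by (rule dvdI)
  then have "cps2_X ^ n dvd w" by (rule Suc.IH)
  then show ?case unfolding w power_Suc by (rule mult_dvd_mono[OF dvd_refl])
qed simp

text \<open>The multipliers that take \<open>c\<close> into (h) form an ideal containing
  \<open>h\<close> and \<open>k\<close>, hence x^n and y^m. These two powers share no factor, so
  \<open>h\<close> already divides \<open>c\<close>; this argument uses no unique
  factorization.\<close>

lemma dvd_cancel_if_finite_colength:
  assumes X: "cps2_X ^ n \<in> ideal_gen {h, k}" and Y: "cps2_Y ^ m \<in> ideal_gen {h, k}"
    and dvd: "h dvd k * c"
  shows "h dvd c"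
proof (cases "h = 0")
  case True
  then have "k * c = 0" using dvd by simp
  moreover have "k \<noteq> 0"
  proof
    assume "k = 0"
    then have "cps2_X ^ n = 0" using X True unfolding ideal_gen_pair by auto
    moreover note cps2_X_nonzero
    ultimately show False by simp
  qed
  ultimately show ?thesis by simp
next
  case False
  have mem: "h dvd t * c" if t: "t \<in> ideal_gen {h, k}" for t
  proof -
    obtain a b where "t = a * h + b * k" using t unfolding ideal_gen_pair by blast
    then have "t * c = h * (a * c) + b * (k * c)" by algebra
    then show ?thesis using dvd by (simp only: dvd_add dvd_triv_left dvd_mult)
  qed
  obtain u v where uv: "cps2_X ^ n * c = h * u" "cps2_Y ^ m * c = h * v"
    using mem[OF X] mem[OF Y] by blast
  \<comment> \<open>Comparing the two expressions for x^n y^m c and cancelling \<open>h\<close>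
    shows that x^n divides y^m u.\<close>
  have "h * (cps2_Y ^ m * u) = cps2_Y ^ m * (h * u)" by (simp only: mult_ac)
  also have "\<dots> = cps2_Y ^ m * (cps2_X ^ n * c)" by (simp only: uv)
  also have "\<dots> = cps2_X ^ n * (cps2_Y ^ m * c)" by (simp only: mult_ac)
  also have "\<dots> = cps2_X ^ n * (h * v)" by (simp only: uv)
  also have "\<dots> = h * (cps2_X ^ n * v)" by (simp only: mult_ac)
  finally have "cps2_Y ^ m * u = cps2_X ^ n * v" using False by simp
  then have "cps2_X ^ n dvd cps2_Y ^ m * u" by (rule dvdI)
  then have "cps2_X ^ n dvd u" by (rule cps2_X_power_dvd_Y_power_mult)
  then obtain w where "u = cps2_X ^ n * w" by (elim dvdE)
  then have "cps2_X ^ n * c = cps2_X ^ n * (h * w)" using uv(1) by (simp only: mult_ac)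
  moreover note cps2_X_nonzero
  ultimately have "c = h * w" by simp
  then show ?thesis by (rule dvdI)
qed

section \<open>Linear change of the pair\<close>

lemma const_cps2_mult_inverse: "c \<noteq> 0 \<Longrightarrow> const_cps2 (inverse c) * const_cps2 c = 1"
  by transfer simp

lemma const_cps2_det:
  "const_cps2 (\<alpha> * \<delta> - \<beta> * \<gamma>)
    = const_cps2 \<alpha> * const_cps2 \<delta> - const_cps2 \<beta> * const_cps2 \<gamma>"
  by transfer simp

lemma ideal_gen_triple: "ideal_gen {p, q, r} = {a * p + b * q + c * r | a b c. True}"
proof (intro set_eqI iffI)
  fix x assume "x \<in> ideal_gen {p, q, r}"
  then obtain a where "x - a * p \<in> ideal_gen {q, r}"
    unfolding cps2_ideal.span_insert[of p] by blast
  then obtain b c where "x - a * p = b * q + c * r" unfolding ideal_gen_pair by blast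
  then have "x = a * p + b * q + c * r" by algebra
  then show "x \<in> {a * p + b * q + c * r | a b c. True}" by blast
next
  fix x assume "x \<in> {a * p + b * q + c * r | a b c. True}"
  then obtain a b c where x: "x = a * p + b * q + c * r" by blast
  show "x \<in> ideal_gen {p, q, r}"
    unfolding x
    by (intro cps2_ideal.span_add cps2_ideal.span_scale[OF cps2_ideal.span_base]) simp_all
qed

lemma ideal_gen_eqI: "S \<subseteq> ideal_gen T \<Longrightarrow> T \<subseteq> ideal_gen S \<Longrightarrow> ideal_gen S = ideal_gen T"
  by (simp add: cps2_ideal.span_minimal subset_antisym)

text \<open>The form g df - f dg is bilinear over the constants and alternating in (f, g), so a
  linear change multiplies it by the determinant; an invertible change keeps the ideal.\<close>

lemma omega_linear_change:
  fixes \<alpha> \<beta> \<gamma> \<delta> :: complex and f g :: cps2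
  defines "\<Delta> \<equiv> \<alpha> * \<delta> - \<beta> * \<gamma>"
  assumes "\<Delta> \<noteq> 0"
  shows "omega_x (fiber \<alpha> \<beta> f g) (fiber \<gamma> \<delta> f g) = const_cps2 \<Delta> * omega_x f g"
    and "omega_y (fiber \<alpha> \<beta> f g) (fiber \<gamma> \<delta> f g) = const_cps2 \<Delta> * omega_y f g"
    and "ideal_gen {fiber \<alpha> \<beta> f g, fiber \<gamma> \<delta> f g} = ideal_gen {f, g}"
proof -
  show "omega_x (fiber \<alpha> \<beta> f g) (fiber \<gamma> \<delta> f g) = const_cps2 \<Delta> * omega_x f g"
    unfolding omega_x_def fiber_def dx_add dx_mult dx_const \<Delta>_def const_cps2_det by algebra
  show "omega_y (fiber \<alpha> \<beta> f g) (fiber \<gamma> \<delta> f g) = const_cps2 \<Delta> * omega_y f g"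
    unfolding omega_y_def fiber_def dy_add dy_mult dy_const \<Delta>_def const_cps2_det by algebra
  define e where "e = const_cps2 (inverse \<Delta>)"
  have e: "e * (const_cps2 \<alpha> * const_cps2 \<delta> - const_cps2 \<beta> * const_cps2 \<gamma>) = 1"
    using const_cps2_mult_inverse[OF assms(2)] unfolding e_def[symmetric]
    unfolding \<Delta>_def const_cps2_det .
  \<comment> \<open>Cramer's rule, with \<open>e\<close> the inverse of the determinant.\<close>
  have "f = (e * const_cps2 \<delta>) * fiber \<alpha> \<beta> f g + (- (e * const_cps2 \<beta>)) * fiber \<gamma> \<delta> f g"
    "g = (- (e * const_cps2 \<gamma>)) * fiber \<alpha> \<beta> f g + (e * const_cps2 \<alpha>) * fiber \<gamma> \<delta> f g"
    using e unfolding fiber_def by algebra+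
  then have "{f, g} \<subseteq> ideal_gen {fiber \<alpha> \<beta> f g, fiber \<gamma> \<delta> f g}"
    unfolding ideal_gen_pair by blast
  moreover have "{fiber \<alpha> \<beta> f g, fiber \<gamma> \<delta> f g} \<subseteq> ideal_gen {f, g}"
    unfolding ideal_gen_pair fiber_def by blast
  ultimately show "ideal_gen {fiber \<alpha> \<beta> f g, fiber \<gamma> \<delta> f g} = ideal_gen {f, g}"
    by (intro ideal_gen_eqI)
qed

lemma ideal_gen_unit_mult:
  assumes "u dvd 1"
  shows "ideal_gen {u * p, u * q} = ideal_gen {p, q}"
    and "ideal_gen {u * p, u * q, r} = ideal_gen {p, q, r}"
proof -
  obtain v where v: "1 = u * v" using assms by (elim dvdE)
  have eq: "w = v * (u * w)" for w using v by algebra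
  have *: "p \<in> ideal_gen S" if "u * p \<in> ideal_gen S" for p S
    using cps2_ideal.span_scale[OF that, of v] by (simp only: eq[symmetric])
  show "ideal_gen {u * p, u * q} = ideal_gen {p, q}"
    by (rule ideal_gen_eqI) (auto intro: cps2_ideal.span_scale cps2_ideal.span_base *)
  show "ideal_gen {u * p, u * q, r} = ideal_gen {p, q, r}"
    by (rule ideal_gen_eqI) (auto intro: cps2_ideal.span_scale cps2_ideal.span_base *)
qed

text \<open>Multiplication by \<open>k\<close> identifies \<open>\<O>/(h, h\<^sub>x, h\<^sub>y)\<close> with
  \<open>(h, k)/(h, k h\<^sub>x, k h\<^sub>y)\<close>, because \<open>k\<close> is not a zero divisor modulo \<open>h\<close>.\<close>

lemma mult_mem_ideal_iff:
  assumes X: "cps2_X ^ n \<in> ideal_gen {h, k}" and Y: "cps2_Y ^ m \<in> ideal_gen {h, k}"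
  shows "k * a \<in> ideal_gen {omega_x h k, omega_y h k, h} \<longleftrightarrow> a \<in> ideal_gen {h, dx h, dy h}"
proof
  assume "k * a \<in> ideal_gen {omega_x h k, omega_y h k, h}"
  then obtain x y z where "k * a = x * omega_x h k + y * omega_y h k + z * h"
    unfolding ideal_gen_triple by blast
  \<comment> \<open>Each coefficient of the form is k times a derivative of \<open>h\<close> minus
    \<open>h\<close> times a derivative of \<open>k\<close>; all multiples of \<open>h\<close> are
    moved to the right.\<close>
  then have "k * (a - x * dx h - y * dy h) = h * (z - x * dx k - y * dy k)"
    unfolding omega_x_def omega_y_def by algebra
  then have "h dvd k * (a - x * dx h - y * dy h)" by (rule dvdI)
  then have "h dvd a - x * dx h - y * dy h" by (rule dvd_cancel_if_finite_colength[OF X Y])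
  then obtain w where "a - x * dx h - y * dy h = h * w" by (elim dvdE)
  then have "a = w * h + x * dx h + y * dy h" by algebra
  then show "a \<in> ideal_gen {h, dx h, dy h}" unfolding ideal_gen_triple by blast
next
  assume "a \<in> ideal_gen {h, dx h, dy h}"
  then obtain x y z where "a = x * h + y * dx h + z * dy h"
    unfolding ideal_gen_triple by blast
  then have "k * a = y * omega_x h k + z * omega_y h k + (k * x + y * dx k + z * dy k) * h"
    unfolding omega_x_def omega_y_def by algebra
  then show "k * a \<in> ideal_gen {omega_x h k, omega_y h k, h}"
    unfolding ideal_gen_triple by blast
qed

lemma ex_quot_basis_superideal:
  assumes "finite B" "\<And>F. \<exists>b\<in>cps2.span B. F - b \<in> ideal_gen S" "ideal_gen S \<subseteq> ideal_gen T"
  shows "\<exists>C. cps2.quot_basis UNIV (ideal_gen T) C"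
  using assms by (intro cps2.ex_quot_basis[of _ B] ideal_gen_complex_subspace) blast+

text \<open>Take bases \<open>C\<close> of O/K, \<open>D\<close> of O/J and \<open>E\<close> of K/I.
  Then mu = |C| + |E|, nu = |E| and tau = |D|, while the chain L \<subseteq> K \<subseteq> O gives
  |C| + |D| for the pair, since K/L is isomorphic to O/J.\<close>

lemma tjurina_formula:
  assumes "cps2_X ^ n \<in> ideal_gen {omega_x h k, omega_y h k}"
    and "cps2_Y ^ m \<in> ideal_gen {omega_x h k, omega_y h k}"
  obtains \<tau>_pair \<tau> \<mu> \<nu> where
    "cps2_quot_dim UNIV (ideal_gen {omega_x h k, omega_y h k, h}) = enat \<tau>_pair"
    "tjurina h = enat \<tau>" "milnor_pair h k = enat \<mu>" "suwa h k = enat \<nu>"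
    "\<tau>_pair + \<nu> = \<tau> + \<mu>"
proof -
  define I where "I = ideal_gen {omega_x h k, omega_y h k}"
  define K where "K = ideal_gen {h, k}"
  define L where "L = ideal_gen {omega_x h k, omega_y h k, h}"
  define J where "J = ideal_gen {h, dx h, dy h}"
  note defs = I_def K_def L_def J_def
  have sub [simp]: "cps2.subspace I" "cps2.subspace K" "cps2.subspace L" "cps2.subspace J"
    "cps2.subspace UNIV"
    by (simp_all add: defs ideal_gen_complex_subspace)
  have IK: "I \<subseteq> K" unfolding defs by (rule omega_ideal_subset)
  have IL: "I \<subseteq> L" unfolding defs by (rule cps2_ideal.span_mono) blast
  have LK: "L \<subseteq> K"
    unfolding L_def
  proof (rule cps2_ideal.span_minimal)
    show "{omega_x h k, omega_y h k, h} \<subseteq> K"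
      using IK cps2_ideal.span_superset[of "{omega_x h k, omega_y h k}"]
        cps2_ideal.span_superset[of "{h, k}"] unfolding defs by blast
  qed (simp add: K_def)
  have mem_iff: "k * a \<in> L \<longleftrightarrow> a \<in> J" for a
    unfolding L_def J_def
    by (rule mult_mem_ideal_iff) (use assms IK in \<open>auto simp: defs\<close>)
  obtain B where B: "finite B" "\<And>F. \<exists>b\<in>cps2.span B. F - b \<in> I"
    by (rule finite_spanning_mod_ideal[OF assms, folded I_def]) (rule that)
  \<comment> \<open>This inclusion transfers finite codimension from \<open>I\<close> to
    \<open>J\<close>, so the Tjurina number of \<open>h\<close> is finite.\<close>
  have IJ: "I \<subseteq> J"
  proof
    fix a assume "a \<in> I"
    then obtain x y where "a = x * omega_x h k + y * omega_y h k"
      unfolding I_def ideal_gen_pair by blast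
    then have "a = (- (x * dx k + y * dy k)) * h + (x * k) * dx h + (y * k) * dy h"
      unfolding omega_x_def omega_y_def by algebra
    then show "a \<in> J" unfolding J_def ideal_gen_triple by blast
  qed
  obtain C where C: "cps2.quot_basis UNIV K C"
    using ex_quot_basis_superideal[OF B[unfolded I_def] IK[unfolded defs]] unfolding K_def by blast
  obtain D where D: "cps2.quot_basis UNIV J D"
    using ex_quot_basis_superideal[OF B[unfolded I_def] IJ[unfolded defs]] unfolding J_def by blast
  have "\<exists>E. cps2.quot_basis K I E"
  proof (rule cps2.ex_quot_basis)
    \<comment> \<open>\<open>K\<close> is generated by \<open>h\<close> and \<open>k\<close> over O,
      and \<open>B\<close> spans O modulo \<open>I\<close>; hence the products of \<open>B\<close>
      with the two generators span \<open>K\<close> modulo \<open>I\<close>.\<close>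
    define E where "E = (\<lambda>b. b * h) ` B \<union> (\<lambda>b. b * k) ` B"
    show "finite E" using B(1) by (simp add: E_def)
    show "E \<subseteq> K"
      unfolding E_def K_def by (auto intro: cps2_ideal.span_scale cps2_ideal.span_base)
    have span_mult: "b * c \<in> cps2.span E"
      if b: "b \<in> cps2.span B" and E: "(\<lambda>b. b * c) ` B \<subseteq> E" for b c
    proof -
      obtain u where u: "b = (\<Sum>v\<in>B. scale_cps2 (u v) v)"
        using b unfolding cps2.span_finite[OF B(1)] by blast
      have "b * c = (\<Sum>v\<in>B. scale_cps2 (u v) (v * c))"
        by (simp only: u sum_distrib_right scale_cps2_def mult.assoc)
      also have "\<dots> \<in> cps2.span E"
        using E by (intro cps2.span_sum cps2.span_scale cps2.span_base) auto
      finally show ?thesis .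
    qed
    fix v assume "v \<in> K"
    then obtain x y where v: "v = x * h + y * k" unfolding K_def ideal_gen_pair by blast
    obtain a b where ab: "a \<in> cps2.span B" "x - a \<in> I" "b \<in> cps2.span B" "y - b \<in> I"
      using B(2) by meson
    have "h * (x - a) + k * (y - b) \<in> I"
      using ab unfolding I_def by (intro cps2_ideal.span_add cps2_ideal.span_scale)
    also have "h * (x - a) + k * (y - b) = v - (a * h + b * k)" unfolding v by algebra
    finally have "v - (a * h + b * k) \<in> I" .
    moreover have "a * h + b * k \<in> cps2.span E"
      using ab by (intro cps2.span_add span_mult) (auto simp: E_def)
    ultimately show "\<exists>w\<in>cps2.span E. v - w \<in> I" by blast
  qed simp
  then obtain E where E: "cps2.quot_basis K I E" by blast
  have range: "range ((*) k) \<subseteq> K"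
    by (auto simp: K_def mult.commute[of k] intro: cps2_ideal.span_scale cps2_ideal.span_base)
  \<comment> \<open>Modulo \<open>L\<close>, which contains \<open>h\<close>, every element of (h,
    k) is a multiple of \<open>k\<close>.\<close>
  have surj: "\<exists>v\<in>UNIV. v' - k * v \<in> L" if v': "v' \<in> K" for v'
  proof -
    obtain x y where "v' = x * h + y * k" using v' unfolding K_def ideal_gen_pair by blast
    then have "v' - k * y = x * h" by algebra
    also have "\<dots> \<in> L"
      unfolding L_def by (intro cps2_ideal.span_scale cps2_ideal.span_base) simp
    finally show ?thesis by blast
  qed
  have scale: "k * scale_cps2 c x = scale_cps2 c (k * x)" for c x
    by (simp add: scale_cps2_def mult.left_commute)
  note D' = cps2.quot_basis_image[of "(*) k", OF distrib_left scale sub(5,3) range mem_iff surj D]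
  show thesis
  proof (rule that)
    show "cps2_quot_dim UNIV (ideal_gen {omega_x h k, omega_y h k, h}) = enat (card C + card D)"
      using cps2.quot_basis_Un[OF _ _ LK _ C D'(1)] cps2.quot_dim_eq_card[of L UNIV] D'(2)
      by (simp add: L_def[symmetric])
    show "tjurina h = enat (card D)"
      using cps2.quot_dim_eq_card[OF _ D] by (simp add: tjurina_def J_def[symmetric])
    show "milnor_pair h k = enat (card C + card E)"
      using cps2.quot_basis_Un[OF _ _ IK _ C E] cps2.quot_dim_eq_card[of I UNIV]
      by (simp add: milnor_pair_def I_def[symmetric])
    show "suwa h k = enat (card E)"
      using cps2.quot_dim_eq_card[OF _ E] by (simp add: suwa_def I_def[symmetric] K_def[symmetric])
  qed simp
qed

theorem corollary2p5:
  fixes f g :: cps2 and \<alpha> \<beta> :: complex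
  assumes "coprime f g"
    and "omega_isolated_singularity f g"
    and "(\<alpha>, \<beta>) \<noteq> (0, 0)"
    and "squarefree (fiber \<alpha> \<beta> f g)"
  shows "\<exists>\<tau>_fg \<tau> \<mu> \<nu> :: nat.
    tjurina_pair \<alpha> \<beta> f g = enat \<tau>_fg \<and> tjurina (fiber \<alpha> \<beta> f g) = enat \<tau> \<and>
    milnor_pair f g = enat \<mu> \<and> suwa f g = enat \<nu> \<and>
    int \<tau>_fg = int \<tau> + int \<mu> - int \<nu>"
proof -
  \<comment> \<open>A second row completing (\<alpha>, \<beta>) to an invertible matrix: (1, 0) if
    \<alpha> = 0, and (0, 1) otherwise.\<close>
  obtain \<gamma> \<delta> where det: "\<alpha> * \<delta> - \<beta> * \<gamma> \<noteq> 0"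
  proof (cases "\<alpha> = 0")
    case True
    then show thesis using assms(3) that[of 0 1] by simp
  next
    case False
    then show thesis using that[of 1 0] by simp
  qed
  define h k u where "h = fiber \<alpha> \<beta> f g" and "k = fiber \<gamma> \<delta> f g"
    and "u = const_cps2 (\<alpha> * \<delta> - \<beta> * \<gamma>)"
  note change = omega_linear_change[OF det, of f g, folded h_def k_def u_def]
  have "u dvd 1"
    using const_cps2_mult_inverse[OF det] unfolding u_def by (metis dvd_triv_right)
  \<comment> \<open>The determinant is a unit, so replacing (f, g) by (h, k) changes none of the
    ideals generated by the coefficients of the form, with or without a third generator.\<close>
  note ideals = ideal_gen_unit_mult[OF this, of "omega_x f g" "omega_y f g", folded change(1,2)]
  have "isolated_common_zero (omega_x f g) (omega_y f g)"
    using assms(2) by (simp add: omega_isolated_singularity_iff)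
  then obtain n m where "cps2_X ^ n \<in> ideal_gen {omega_x f g, omega_y f g}"
    "cps2_Y ^ m \<in> ideal_gen {omega_x f g, omega_y f g}"
    by (rule isolated_common_zero_ideal)
  then obtain \<tau>_pair \<tau> \<mu> \<nu> where
    "cps2_quot_dim UNIV (ideal_gen {omega_x h k, omega_y h k, h}) = enat \<tau>_pair"
    "tjurina h = enat \<tau>" "milnor_pair h k = enat \<mu>" "suwa h k = enat \<nu>"
    "\<tau>_pair + \<nu> = \<tau> + \<mu>"
    unfolding ideals(1)[symmetric] by (rule tjurina_formula)
  then have "tjurina_pair \<alpha> \<beta> f g = enat \<tau>_pair" "tjurina (fiber \<alpha> \<beta> f g) = enat \<tau>"
    "milnor_pair f g = enat \<mu>" "suwa f g = enat \<nu>" "int \<tau>_pair = int \<tau> + int \<mu> - int \<nu>"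
    unfolding tjurina_pair_def milnor_pair_def suwa_def ideals change(3) h_def[symmetric] by auto
  then show ?thesis by blast
qed

end
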